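(* Let $c^1,\dots,c^k\in\mathbb{R}^d$ be any set of centers, $\delta\in(0,1)$, and let $\mathcal{T}$ be the (random) threshold tree output by the Threshold Tree Construction algorithm described in the context. Then for every $x\in\mathbb{R}^d$, $$\mathbf{E}\big[\|x-\mathcal{T}(x)\|_2^2\big]\le O\!\left(\tfrac{1}{\delta}\log^2 k\,\log\log k\right)\min_{c\in\{c^1,\dots,c^k\}}\|x-c\|_2^2,$$ where the constant in $O(\cdot)$ is absolute.
   Context: Threshold tree: rooted binary tree of cells of $\mathbb{R}^d$, root $=\mathbb{R}^d$; an internal node $u$ split by cut $(i,\xi)$ has children $u_{left}=\{y\in u:y_i\le\xi\}$, $u_{right}=\{y\in u: y_i>\xi\}$. A median of a finite nonempty set $S\subset\mathbb{R}^d$ is a point $m$ such that for every coordinate $i$ each of $\{c\in S:c_i<m_i\}$ and $\{c\in S: c_i>m_i\}$ has at most $|S|/2$ elements. Algorithm (input $C=\{c^1,\dots,c^k\}$, $\delta$): set $\varepsilon=\min\{\delta/(15\ln k),1/320\}$. Start with $\mathcal{T}_1$ consisting of a root $r$ with assigned center set $C_r=C$. For $t=1,2,\dots$, while some leaf of $\mathcal{T}_t$ has at least two centers assigned: sample independently $i_t$ uniform in $\{1,\dots,d\}$, $\theta_t$ uniform in $(0,1)$, $\sigma_t$ uniform in $\{\pm1\}$; for every leaf $u$ of $\mathcal{T}_t$ with $|C_u|\ge2$ apply Divide-and-Share with $(i,\theta,\sigma)=(i_t,\theta_t,\sigma_t)$; the resulting tree is $\mathcal{T}_{t+1}$. Divide-and-Share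 on $u$: let $m^u$ be a median of $C_u$, $R_u=\max_{c\in C_u}\|c-m^u\|_2$, $Left=\{c\in C_u: c_i\le m^u_i+(\sigma+\varepsilon)\sqrt{\theta}R_u\}$, $Right=\{c\in C_u: c_i\ge m^u_i+(\sigma-\varepsilon)\sqrt\theta R_u\}$. If both are nonempty, split $u$ by the cut $(i,\,m^u_i+\sigma\sqrt\theta R_u)$ and assign $Left$ to $u_{left}$ and $Right$ to $u_{right}$; otherwise leave $u$ unchanged. In the output tree $\mathcal{T}$ each leaf has exactly one assigned center, and $\mathcal{T}(y)$ is the center of the leaf containing $y$. *)

theory Defs
  imports "HOL-Probability.Probability"
begin

text \<open>Points of R^d are represented as functions nat \<Rightarrow> real; only the coordinates
  0..<d are meaningful (centers are required to vanish outside 0..<d).\<close>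

type_synonym pt = "nat \<Rightarrow> real"
type_synonym leaf = "pt set \<times> pt set"   \<comment> \<open>(cell, assigned center set)\<close>
type_synonym sample = "nat \<times> real \<times> bool" \<comment> \<open>(i, theta, sigma = +1 iff True)\<close>

definition sqdist :: "nat \<Rightarrow> pt \<Rightarrow> pt \<Rightarrow> real" where
  "sqdist d x y = (\<Sum>i<d. (x i - y i)\<^sup>2)"

definition dist_d :: "nat \<Rightarrow> pt \<Rightarrow> pt \<Rightarrow> real" where
  "dist_d d x y = sqrt (sqdist d x y)"

definition is_median :: "nat \<Rightarrow> pt set \<Rightarrow> pt \<Rightarrow> bool" where
  "is_median d S m \<longleftrightarrow> (\<forall>i<d.
      real (card {c\<in>S. c i < m i}) \<le> real (card S) / 2 \<and>
      real (card {c\<in>S. c i > m i}) \<le> real (card S) / 2)"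

definition sign_of :: "bool \<Rightarrow> real" where
  "sign_of b = (if b then 1 else -1)"

definition eps_param :: "real \<Rightarrow> nat \<Rightarrow> real" where
  "eps_param \<delta> k = min (\<delta> / (15 * ln (real k))) (1 / 320)"

definition divide_share :: "nat \<Rightarrow> (pt set \<Rightarrow> pt) \<Rightarrow> real \<Rightarrow> sample \<Rightarrow> leaf \<Rightarrow> leaf set" where
  "divide_share d med \<epsilon> s u = (case s of (i, \<theta>, b) \<Rightarrow> case u of (A, S) \<Rightarrow>
     let \<sigma> = sign_of b; m = med S; R = Max ((\<lambda>c. dist_d d c m) ` S);
         Lf = {c\<in>S. c i \<le> m i + (\<sigma> + \<epsilon>) * sqrt \<theta> * R};
         Rt = {c\<in>S. c i \<ge> m i + (\<sigma> - \<epsilon>) * sqrt \<theta> * R};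
         \<xi> = m i + \<sigma> * sqrt \<theta> * R
     in if Lf \<noteq> {} \<and> Rt \<noteq> {}
        then {(A \<inter> {y. y i \<le> \<xi>}, Lf), (A \<inter> {y. y i > \<xi>}, Rt)}
        else {u})"

definition tree_step :: "nat \<Rightarrow> (pt set \<Rightarrow> pt) \<Rightarrow> real \<Rightarrow> sample \<Rightarrow> leaf set \<Rightarrow> leaf set" where
  "tree_step d med \<epsilon> s L = (\<Union>u\<in>L. if card (snd u) \<ge> 2 then divide_share d med \<epsilon> s u else {u})"

text \<open>Leaves of the tree T_{t+1} after t rounds, driven by the sample sequence \<omega>.\<close>
fun leaves :: "nat \<Rightarrow> (pt set \<Rightarrow> pt) \<Rightarrow> real \<Rightarrow> pt set \<Rightarrow> (nat \<Rightarrow> sample) \<Rightarrow> nat \<Rightarrow> leaf set" where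
  "leaves d med \<epsilon> C \<omega> 0 = {(UNIV, C)}"
| "leaves d med \<epsilon> C \<omega> (Suc t) = tree_step d med \<epsilon> (\<omega> t) (leaves d med \<epsilon> C \<omega> t)"

definition finished :: "leaf set \<Rightarrow> bool" where
  "finished L \<longleftrightarrow> (\<forall>u\<in>L. card (snd u) \<le> 1)"

definition tree_cost :: "nat \<Rightarrow> (pt set \<Rightarrow> pt) \<Rightarrow> real \<Rightarrow> pt set \<Rightarrow> pt \<Rightarrow> (nat \<Rightarrow> sample) \<Rightarrow> ennreal" where
  "tree_cost d med \<epsilon> C x \<omega> =
     (if \<exists>t. finished (leaves d med \<epsilon> C \<omega> t) then
        (let t0 = (LEAST t. finished (leaves d med \<epsilon> C \<omega> t));
             c = (THE c. \<exists>A. (A, {c}) \<in> leaves d med \<epsilon> C \<omega> t0 \<and> x \<in> A)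
         in ennreal (sqdist d x c))
      else \<infinity>)"

definition sample_measure :: "nat \<Rightarrow> sample measure" where
  "sample_measure d = measure_pmf (pmf_of_set {0..<d}) \<Otimes>\<^sub>M
      (uniform_measure lborel {0<..<1} \<Otimes>\<^sub>M measure_pmf (pmf_of_set (UNIV :: bool set)))"

definition run_space :: "nat \<Rightarrow> (nat \<Rightarrow> sample) measure" where
  "run_space d = PiM UNIV (\<lambda>_. sample_measure d)"

end

theory Submission
  imports Defs
begin

text \<open>Follow only the set \<open>S\<close> of centers in the leaf of \<open>x\<close>: it is a Markov chain on the nonempty subsets of
  \<open>C\<close>, so the expected final cost is at most \<open>\<Phi> C\<close> for every nonnegative function \<open>\<Phi>\<close> that is superharmonic
  for this chain and dominates the cost on singletons (Fatou, plus almost sure termination).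

  Let \<open>c\<close> be the center closest to \<open>x\<close>, \<open>D\<close> its distance, \<open>W\<close> the distance of the farthest center in \<open>S\<close>.
  As long as \<open>c\<close> survives, each center at distance of order \<open>W\<close> leaves, or \<open>S\<close> is halved (medians), with
  probability of order \<open>1/d\<close>, so each scale of \<open>W\<close> lasts \<open>O(d log k)\<close> rounds.  A round loses \<open>c\<close> with probability
  \<open>O(D/(d W))\<close>, and the final cost is at most \<open>W\<^sup>2\<close>; summing the geometric series over the scales gives the
  bound \<open>O(log k \<cdot> D W)\<close> from every state and for every center of that state.

  Sharing improves this.  The loss of \<open>c\<close> through coordinate \<open>i\<close> has density \<open>O(|x\<^sub>i - c\<^sub>i| / (d \<epsilon> W\<^sup>2))\<close> in the
  position of the cut.  For a fixed position the surviving centers form a fixed part \<open>P\<close> of \<open>S\<close>; if \<open>r\<close> is the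
  distance from \<open>x\<close> to \<open>S \<inter> P\<close>, the loss is at most \<open>W\<^sup>2 min(1, log k \<cdot> r/W)\<close> by the first bound, hence of
  order \<open>W\<^sup>2\<close> only on the \<open>O(log log k)\<close> scales between \<open>r\<close> and \<open>r log k\<close>.  Integrating over the positions and
  summing over the coordinates gives \<open>O(log k log log k / \<epsilon>) D\<^sup>2\<close>.\<close>

section \<open>Markov chains driven by independent samples\<close>

primrec chain :: "('a \<Rightarrow> 's \<Rightarrow> 'a) \<Rightarrow> 'a \<Rightarrow> (nat \<Rightarrow> 's) \<Rightarrow> nat \<Rightarrow> 'a" where
  "chain f a \<omega> 0 = a"
| "chain f a \<omega> (Suc t) = f (chain f a \<omega> t) (\<omega> t)"

text \<open>Prepending a sample moves the starting state by one step. This is the Markov property in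
  the form that fits the splitting of the sequence space by \<open>case_nat\<close>.\<close>

lemma chain_case_nat: "chain f a (case_nat s \<omega>) (Suc t) = chain f (f a s) \<omega> t"
  by (induction t) auto

lemma measurable_chain:
  assumes "countable A" and f: "\<And>a. a \<in> A \<Longrightarrow> f a \<in> M \<rightarrow>\<^sub>M count_space A" and "a \<in> A"
  shows "(\<lambda>\<omega>. chain f a \<omega> t) \<in> PiM UNIV (\<lambda>_. M) \<rightarrow>\<^sub>M count_space A"
proof (induction t)
  case 0
  then show ?case using \<open>a \<in> A\<close> by simp
next
  case (Suc t)
  have "(\<lambda>\<omega>. f (chain f a \<omega> t) (\<omega> t)) \<in> PiM UNIV (\<lambda>_. M) \<rightarrow>\<^sub>M count_space A"
    by (rule measurable_compose_countable'[OF _ Suc.IH \<open>countable A\<close>])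
      (rule measurable_compose[OF measurable_component_singleton[of _ UNIV "\<lambda>_. M"] f], auto)
  then show ?case by simp
qed

text \<open>Split off the first sample by \<open>PiM_iter\<close>, apply the induction hypothesis to
  the remaining ones and the one-step bound to the first. The case \<open>q = 1\<close> serves
  superharmonic functions, the case \<open>q < 1\<close> gives the geometric decay behind
  termination.\<close>

lemma nn_integral_chain_le:
  fixes \<phi> :: "'a \<Rightarrow> ennreal"
  assumes M: "prob_space M" and A: "countable A" and f: "\<And>a. a \<in> A \<Longrightarrow> f a \<in> M \<rightarrow>\<^sub>M count_space A"
    and \<phi>: "\<And>a. a \<in> A \<Longrightarrow> (\<integral>\<^sup>+s. \<phi> (f a s) \<partial>M) \<le> q * \<phi> a" and "a \<in> A"
  shows "(\<integral>\<^sup>+\<omega>. \<phi> (chain f a \<omega> t) \<partial>PiM UNIV (\<lambda>_. M)) \<le> q ^ t * \<phi> a"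
  using \<open>a \<in> A\<close>
proof (induction t arbitrary: a)
  interpret M: prob_space M by fact
  interpret sequence_space M by standard
  {
    case 0
    then show ?case by (simp add: P.emeasure_space_1)
  next
    case (Suc t)
    have meas: "(\<lambda>\<omega>. \<phi> (chain f a \<omega> t)) \<in> borel_measurable S" if "a \<in> A" for a t
      by (rule measurable_compose[OF measurable_chain[OF A f that]]) auto
    have cn: "(\<lambda>(s, \<omega>). case_nat s \<omega>) \<in> M \<Otimes>\<^sub>M S \<rightarrow>\<^sub>M S"
      unfolding split_beta' by (rule measurable_case_nat') auto
    have "(\<integral>\<^sup>+\<omega>. \<phi> (chain f a \<omega> (Suc t)) \<partial>S)
        = (\<integral>\<^sup>+\<omega>. \<phi> (chain f a \<omega> (Suc t)) \<partial>distr (M \<Otimes>\<^sub>M S) S (\<lambda>(s, \<omega>). case_nat s \<omega>))"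
      by (simp add: PiM_iter del: chain.simps)
    also have "\<dots> = (\<integral>\<^sup>+z. \<phi> (chain f a (case z of (s, \<omega>) \<Rightarrow> case_nat s \<omega>) (Suc t)) \<partial>(M \<Otimes>\<^sub>M S))"
      by (rule nn_integral_distr[OF cn]) (use meas[OF Suc.prems, of "Suc t"] in \<open>simp del: chain.simps\<close>)
    also have "\<dots> = (\<integral>\<^sup>+s. \<integral>\<^sup>+\<omega>. \<phi> (chain f a (case_nat s \<omega>) (Suc t)) \<partial>S \<partial>M)"
      by (subst P.nn_integral_fst[symmetric, OF measurable_compose[OF cn meas[OF Suc.prems]]])
        (simp del: chain.simps)
    also have "\<dots> = (\<integral>\<^sup>+s. \<integral>\<^sup>+\<omega>. \<phi> (chain f (f a s) \<omega> t) \<partial>S \<partial>M)"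
      by (simp only: chain_case_nat)
    also have "\<dots> \<le> (\<integral>\<^sup>+s. q ^ t * \<phi> (f a s) \<partial>M)"
      using measurable_space[OF f[OF Suc.prems]] by (intro nn_integral_mono Suc.IH) auto
    also have "\<dots> = q ^ t * (\<integral>\<^sup>+s. \<phi> (f a s) \<partial>M)"
      by (rule nn_integral_cmult) (rule measurable_compose[OF f[OF Suc.prems]], auto)
    also have "\<dots> \<le> q ^ t * (q * \<phi> a)"
      by (intro mult_left_mono \<phi> Suc.prems) auto
    finally show ?case by (simp only: power_Suc2 mult.assoc)
  }
qed

section \<open>The distribution of a cut\<close>

lemma space_sample_measure [simp]: "space (sample_measure d) = UNIV"
  by (simp add: sample_measure_def space_pair_measure)

lemma sets_sample_measure:
  "sets (sample_measure d) = sets (count_space UNIV \<Otimes>\<^sub>M (borel \<Otimes>\<^sub>M count_space UNIV))"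
  unfolding sample_measure_def
  by (intro sets_pair_measure_cong sets_measure_pmf_count_space) simp_all

lemma prob_space_uniform_01: "prob_space (uniform_measure lborel {0<..<1::real})"
  by (rule prob_space_uniform_measure) auto

lemma prob_space_sample_measure: "prob_space (sample_measure d)"
  unfolding sample_measure_def
  by (intro prob_space_pair prob_space_uniform_01 measure_pmf.prob_space_axioms)

lemma nn_integral_sample_measure:
  assumes "d \<ge> 1" and f[measurable]: "f \<in> borel_measurable (sample_measure d)"
  shows "(\<integral>\<^sup>+s. f s \<partial>sample_measure d) =
    (\<Sum>i<d. \<integral>\<^sup>+\<theta>. (f (i, \<theta>, True) + f (i, \<theta>, False)) / 2 * indicator {0<..<1} \<theta> \<partial>lborel) / d"
proof -
  let ?U = "uniform_measure lborel {0<..<1::real}" and ?B = "measure_pmf (pmf_of_set (UNIV :: bool set))"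
  interpret U: prob_space ?U by (rule prob_space_uniform_01)
  interpret UB: prob_space "?U \<Otimes>\<^sub>M ?B"
    by (intro prob_space_pair prob_space_uniform_01 measure_pmf.prob_space_axioms)
  have f'[measurable]: "f \<in> borel_measurable (measure_pmf (pmf_of_set {0..<d}) \<Otimes>\<^sub>M (?U \<Otimes>\<^sub>M ?B))"
    using f by (simp add: sample_measure_def)
  have [measurable]: "(\<lambda>\<theta>. f (i, \<theta>, b)) \<in> borel_measurable borel" for i b
  proof -
    have "f \<in> borel_measurable (count_space UNIV \<Otimes>\<^sub>M (borel \<Otimes>\<^sub>M count_space UNIV))"
      using f sets_sample_measure by (simp cong: measurable_cong_sets)
    then show ?thesis by measurable
  qed
  have "(\<integral>\<^sup>+s. f s \<partial>sample_measure d) =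
    (\<integral>\<^sup>+i. \<integral>\<^sup>+z. f (i, z) \<partial>(?U \<Otimes>\<^sub>M ?B) \<partial>measure_pmf (pmf_of_set {0..<d}))"
    unfolding sample_measure_def by (rule UB.nn_integral_fst[symmetric, OF f'])
  also have "\<dots> = (\<Sum>i<d. \<integral>\<^sup>+z. f (i, z) \<partial>(?U \<Otimes>\<^sub>M ?B)) / d"
    using \<open>d \<ge> 1\<close> by (subst nn_integral_pmf_of_set) (auto simp: atLeast0LessThan lessThan_empty_iff)
  finally have "(\<integral>\<^sup>+s. f s \<partial>sample_measure d) = (\<Sum>i<d. \<integral>\<^sup>+z. f (i, z) \<partial>(?U \<Otimes>\<^sub>M ?B)) / d" .
  moreover have "(\<integral>\<^sup>+z. f (i, z) \<partial>(?U \<Otimes>\<^sub>M ?B)) =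
     (\<integral>\<^sup>+\<theta>. (f (i, \<theta>, True) + f (i, \<theta>, False)) / 2 * indicator {0<..<1} \<theta> \<partial>lborel)" for i
  proof -
    have "(\<integral>\<^sup>+z. f (i, z) \<partial>(?U \<Otimes>\<^sub>M ?B)) = (\<integral>\<^sup>+\<theta>. \<integral>\<^sup>+b. f (i, \<theta>, b) \<partial>?B \<partial>?U)"
    proof (rule measure_pmf.nn_integral_fst[symmetric])
      show "(\<lambda>z. f (i, z)) \<in> borel_measurable (?U \<Otimes>\<^sub>M ?B)"
        by (rule measurable_compose[OF measurable_Pair1' f']) auto
    qed
    also have "\<dots> = (\<integral>\<^sup>+\<theta>. (f (i, \<theta>, True) + f (i, \<theta>, False)) / 2 \<partial>?U)"
      by (subst nn_integral_pmf_of_set) (auto simp: UNIV_bool add.commute)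
    also have "\<dots> = (\<integral>\<^sup>+\<theta>. (f (i, \<theta>, True) + f (i, \<theta>, False)) / 2 * indicator {0<..<1} \<theta> \<partial>lborel)"
      by (subst nn_integral_uniform_measure) (simp_all add: divide_ennreal_def)
    finally show ?thesis .
  qed
  ultimately show ?thesis by simp
qed

text \<open>Substituting \<open>\<theta> = z\<^sup>2\<close> turns the uniform density into
  \<open>2 * z\<close> on the unit interval, which is at most \<open>2 * q\<close> on
  \<open>Z\<close>.\<close>

lemma nn_integral_square_root_le:
  fixes Z :: "real set"
  assumes [measurable]: "Z \<in> sets borel" and q: "\<And>z. z \<in> Z \<Longrightarrow> z \<le> q"
  shows "(\<integral>\<^sup>+\<theta>. indicator Z (sqrt \<theta>) * indicator {0<..<1} \<theta> \<partial>lborel)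
     \<le> ennreal (2 * q) * emeasure lborel (Z \<inter> {0<..})"
proof -
  have "(\<integral>\<^sup>+\<theta>. indicator Z (sqrt \<theta>) * indicator {0<..<1} \<theta> \<partial>lborel)
     \<le> (\<integral>\<^sup>+\<theta>. indicator Z (sqrt \<theta>) * indicator {0\<^sup>2..1\<^sup>2} \<theta> \<partial>lborel)"
    by (intro nn_integral_mono mult_left_mono) (auto simp: indicator_def)
  also have "\<dots> = (\<integral>\<^sup>+z. indicator Z (sqrt (z\<^sup>2)) * ennreal (2 * z) * indicator {0..1} z \<partial>lborel)"
    by (rule nn_integral_substitution_aux) (auto intro!: derivative_eq_intros continuous_intros)
  also have "\<dots> \<le> (\<integral>\<^sup>+z. ennreal (2 * q) * indicator (Z \<inter> {0<..}) z \<partial>lborel)"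
    using q by (intro nn_integral_mono) (auto simp: indicator_def intro!: ennreal_leI)
  also have "\<dots> = ennreal (2 * q) * emeasure lborel (Z \<inter> {0<..})"
    by (subst nn_integral_cmult_indicator) auto
  finally show ?thesis .
qed

text \<open>The signed threshold \<open>z = \<sigma> \<surd>\<theta>\<close> has density \<open>\<bar>z\<bar>\<close> on \<open>(-1, 1)\<close>.\<close>

lemma emeasure_threshold_le:
  assumes "d \<ge> 1" and Z[measurable]: "\<And>i. Z i \<in> sets borel"
    and q: "\<And>i z. i < d \<Longrightarrow> z \<in> Z i \<Longrightarrow> \<bar>z\<bar> \<le> q i"
  shows "emeasure (sample_measure d) {(i, \<theta>, b). sign_of b * sqrt \<theta> \<in> Z i}
    \<le> (\<Sum>i<d. ennreal (q i) * emeasure lborel (Z i)) / d"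
    and "{(i, \<theta>, b). sign_of b * sqrt \<theta> \<in> Z i} \<in> sets (sample_measure d)"
proof -
  let ?A = "{(i, \<theta>, b). sign_of b * sqrt \<theta> \<in> Z i}"
  have "Measurable.pred (count_space UNIV \<Otimes>\<^sub>M (borel \<Otimes>\<^sub>M count_space UNIV))
      (\<lambda>s. sign_of (snd (snd s)) * sqrt (fst (snd s)) \<in> Z (fst s))"
    by (rule measurable_compose_countable[where f="\<lambda>i s. sign_of (snd (snd s)) * sqrt (fst (snd s)) \<in> Z i" and g=fst])
      measurable
  then show A[measurable]: "?A \<in> sets (sample_measure d)"
    by (simp add: sets_sample_measure pred_def space_pair_measure case_prod_beta')
  have core: "(\<integral>\<^sup>+\<theta>. (indicator ?A (i, \<theta>, True) + indicator ?A (i, \<theta>, False)) / 2 * indicator {0<..<1} \<theta> \<partial>lborel)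
      \<le> ennreal (q i) * emeasure lborel (Z i)" if "i < d" for i
  proof -
    \<comment> \<open>With the negative sign the condition says that \<open>sqrt \<theta>\<close>
      lies in the reflected set; invariance of Lebesgue measure undoes the reflection below.\<close>
    let ?Z' = "{z. - z \<in> Z i}"
    have [measurable]: "?Z' \<in> sets borel" by measurable
    have "(\<integral>\<^sup>+\<theta>. (indicator ?A (i, \<theta>, True) + indicator ?A (i, \<theta>, False)) / 2 * indicator {0<..<1} \<theta> \<partial>lborel)
       = (\<integral>\<^sup>+\<theta>. (indicator (Z i) (sqrt \<theta>) * indicator {0<..<1} \<theta> + indicator ?Z' (sqrt \<theta>) * indicator {0<..<1} \<theta>) / 2 \<partial>lborel)"
      by (intro nn_integral_cong) (auto simp: indicator_def sign_of_def)
    also have "\<dots> = ((\<integral>\<^sup>+\<theta>. indicator (Z i) (sqrt \<theta>) * indicator {0<..<1} \<theta> \<partial>lborel)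
         + (\<integral>\<^sup>+\<theta>. indicator ?Z' (sqrt \<theta>) * indicator {0<..<1} \<theta> \<partial>lborel)) / 2"
      by (subst nn_integral_divide, measurable) (subst nn_integral_add, auto)
    also have "\<dots> \<le> (ennreal (2 * q i) * emeasure lborel (Z i \<inter> {0<..})
         + ennreal (2 * q i) * emeasure lborel (?Z' \<inter> {0<..})) / 2"
      using q[OF that] by (intro divide_right_mono_ennreal add_mono nn_integral_square_root_le) force+
    also have "emeasure lborel (?Z' \<inter> {0<..}) = emeasure lborel (Z i \<inter> {..<0})"
    proof -
      have "emeasure lborel (Z i \<inter> {..<0}) = (\<integral>\<^sup>+z. indicator (Z i \<inter> {..<0}) z \<partial>lborel)"
        by simp
      also have "\<dots> = (\<integral>\<^sup>+z. indicator (Z i \<inter> {..<0}) (- z) \<partial>lborel)"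
        by (subst nn_integral_real_affine[where c="-1" and t=0]) auto
      also have "\<dots> = (\<integral>\<^sup>+z. indicator (?Z' \<inter> {0<..}) z \<partial>lborel)"
        by (intro nn_integral_cong) (auto simp: indicator_def)
      finally show ?thesis by simp
    qed
    also have "(ennreal (2 * q i) * emeasure lborel (Z i \<inter> {0<..})
         + ennreal (2 * q i) * emeasure lborel (Z i \<inter> {..<0})) / 2
        = ennreal (2 * q i) * emeasure lborel ((Z i \<inter> {0<..}) \<union> (Z i \<inter> {..<0})) / 2"
      by (subst plus_emeasure[symmetric]) (auto simp: distrib_left)
    also have "\<dots> \<le> ennreal (2 * q i) * emeasure lborel (Z i) / 2"
      by (intro divide_right_mono_ennreal mult_left_mono emeasure_mono) auto
    also have "\<dots> = ennreal (q i) * emeasure lborel (Z i)"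
    proof (cases "0 \<le> q i")
      case True
      then have "ennreal (2 * q i) * emeasure lborel (Z i) = ennreal (q i) * emeasure lborel (Z i) * 2"
        by (simp add: ennreal_mult mult.commute mult.left_commute)
      then show ?thesis by (simp add: mult_divide_eq_ennreal)
    qed (simp add: ennreal_neg)
    finally show ?thesis .
  qed
  have "emeasure (sample_measure d) ?A = (\<integral>\<^sup>+s. indicator ?A s \<partial>sample_measure d)"
    by simp
  also have "\<dots> \<le> (\<Sum>i<d. ennreal (q i) * emeasure lborel (Z i)) / d"
    by (subst nn_integral_sample_measure[OF \<open>d \<ge> 1\<close>])
      (use core in \<open>auto intro!: divide_right_mono_ennreal sum_mono\<close>)
  finally show "emeasure (sample_measure d) ?A \<le> (\<Sum>i<d. ennreal (q i) * emeasure lborel (Z i)) / d" .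
qed

text \<open>Prescribing the sign costs a factor 1/2, and a uniform \<open>\<theta>\<close> lies
  below \<open>(a i)\<^sup>2\<close> with probability \<open>(a i)\<^sup>2\<close>. For
  \<open>a i\<close> proportional to a coordinate difference the sum becomes a squared distance, so
  no coordinate has to be singled out.\<close>

lemma emeasure_threshold_ge:
  assumes "d \<ge> 1" and a: "\<And>i. i < d \<Longrightarrow> 0 \<le> a i \<and> a i \<le> 1"
  shows "emeasure (sample_measure d) {(i, \<theta>, b). b = sg i \<and> 0 < \<theta> \<and> \<theta> < (a i)\<^sup>2}
    \<ge> ennreal ((\<Sum>i<d. (a i)\<^sup>2) / (2 * d))" (is "emeasure _ ?A \<ge> _")
    and "{(i, \<theta>, b). b = sg i \<and> 0 < \<theta> \<and> \<theta> < (a i)\<^sup>2} \<in> sets (sample_measure d)"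
proof -
  have "Measurable.pred (count_space UNIV \<Otimes>\<^sub>M (borel \<Otimes>\<^sub>M count_space UNIV))
      (\<lambda>s. snd (snd s) = sg (fst s) \<and> 0 < fst (snd s) \<and> fst (snd s) < (a (fst s))\<^sup>2)"
    by (rule measurable_compose_countable[where f="\<lambda>i s. snd (snd s) = sg i \<and> 0 < fst (snd s) \<and> fst (snd s) < (a i)\<^sup>2" and g=fst])
      measurable
  then show A[measurable]: "?A \<in> sets (sample_measure d)"
    by (simp add: sets_sample_measure pred_def space_pair_measure case_prod_beta')
  have core: "(\<integral>\<^sup>+\<theta>. (indicator ?A (i, \<theta>, True) + indicator ?A (i, \<theta>, False)) / 2 * indicator {0<..<1} \<theta> \<partial>lborel)
      = ennreal ((a i)\<^sup>2 / 2)" if "i < d" for i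
  proof -
    have "(a i)\<^sup>2 \<le> 1" using a[OF that] by (simp add: power_le_one)
    then have "(\<integral>\<^sup>+\<theta>. (indicator ?A (i, \<theta>, True) + indicator ?A (i, \<theta>, False)) / 2 * indicator {0<..<1} \<theta> \<partial>lborel)
       = (\<integral>\<^sup>+\<theta>. indicator {0<..<(a i)\<^sup>2} \<theta> / 2 \<partial>lborel)"
      by (intro nn_integral_cong, cases "sg i") (auto simp: indicator_def)
    also have "\<dots> = ennreal ((a i)\<^sup>2) / 2"
      by (subst nn_integral_divide) auto
    also have "\<dots> = ennreal ((a i)\<^sup>2 / 2)"
      by (metis divide_ennreal ennreal_numeral zero_le_power2 zero_less_numeral)
    finally show ?thesis .
  qed
  have "emeasure (sample_measure d) ?A = (\<integral>\<^sup>+s. indicator ?A s \<partial>sample_measure d)"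
    by simp
  also have "\<dots> = (\<Sum>i<d. ennreal ((a i)\<^sup>2 / 2)) / d"
    by (subst nn_integral_sample_measure[OF \<open>d \<ge> 1\<close>]) (simp_all add: core)
  also have "\<dots> = ennreal ((\<Sum>i<d. (a i)\<^sup>2 / 2) / d)"
    using \<open>d \<ge> 1\<close> by (subst sum_ennreal) (auto simp: divide_ennreal[symmetric] sum_nonneg ennreal_of_nat_eq_real_of_nat)
  also have "(\<Sum>i<d. (a i)\<^sup>2 / 2) / d = (\<Sum>i<d. (a i)\<^sup>2) / (2 * d)"
    by (simp add: sum_divide_distrib[symmetric])
  finally show "emeasure (sample_measure d) ?A \<ge> ennreal ((\<Sum>i<d. (a i)\<^sup>2) / (2 * d))" by simp
qed

section \<open>The chain of center sets at a point\<close>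

lemma dist_d_L2_set: "dist_d d a b = L2_set (\<lambda>i. a i - b i) {..<d}"
  by (simp add: dist_d_def sqdist_def L2_set_def)

lemma dist_d_triangle: "dist_d d a c \<le> dist_d d a b + dist_d d b c"
  using L2_set_triangle_ineq[of "\<lambda>i. a i - b i" "\<lambda>i. b i - c i" "{..<d}"]
  by (simp add: dist_d_L2_set)

lemma dist_d_commute: "dist_d d a b = dist_d d b a"
  by (simp add: dist_d_def sqdist_def power2_commute)

lemma dist_d_nonneg [simp]: "0 \<le> dist_d d a b"
  by (simp add: dist_d_def sqdist_def sum_nonneg)

lemma dist_d_power2: "(dist_d d a b)\<^sup>2 = (\<Sum>i<d. (a i - b i)\<^sup>2)"
  by (simp add: dist_d_def sqdist_def sum_nonneg)

lemma abs_coord_le_dist_d: "i < d \<Longrightarrow> \<bar>a i - b i\<bar> \<le> dist_d d a b"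
  using member_le_L2_set[of "{..<d}" i "\<lambda>i. \<bar>a i - b i\<bar>"]
  by (simp add: dist_d_L2_set L2_set_def)

text \<open>The query point \<open>x\<close> is a parameter too: \<open>descend\<close> follows the
  cells that contain it. \<open>vanish\<close> lets the first \<open>d\<close> coordinates determine
  a center, and \<open>card_C\<close> makes \<open>ln (card C)\<close> at least 1.\<close>

locale threshold_tree =
  fixes d :: nat and C :: "pt set" and med :: "pt set \<Rightarrow> pt" and x :: pt and \<epsilon> :: real
  assumes d: "d \<ge> 1" and finite_C: "finite C" and card_C: "card C \<ge> 3"
    and vanish: "\<And>c j. c \<in> C \<Longrightarrow> j \<ge> d \<Longrightarrow> c j = 0"
    and median: "\<And>S. S \<subseteq> C \<Longrightarrow> S \<noteq> {} \<Longrightarrow> is_median d S (med S)"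
    and eps_pos: "0 < \<epsilon>" and eps_le: "\<epsilon> \<le> 1 / 320"
begin

abbreviation "M \<equiv> sample_measure d"

sublocale M: prob_space M
  by (rule prob_space_sample_measure)

definition radius :: "pt set \<Rightarrow> real" where
  "radius S = Max ((\<lambda>c. dist_d d c (med S)) ` S)"

text \<open>The \<open>W\<close> of the overview. Scales are measured by it and not by
  \<open>radius\<close>, because it can only decrease when centers leave, whereas a smaller set has
  a new median.\<close>

definition reach :: "pt set \<Rightarrow> real" where
  "reach S = Max (dist_d d x ` S)"

definition cut :: "pt set \<Rightarrow> sample \<Rightarrow> real" where
  "cut S s = med S (fst s) + sign_of (snd (snd s)) * sqrt (fst (snd s)) * radius S"

definition lefts :: "pt set \<Rightarrow> sample \<Rightarrow> pt set" where
  "lefts S s = {c \<in> S. c (fst s) \<le> med S (fst s) + (sign_of (snd (snd s)) + \<epsilon>) * sqrt (fst (snd s)) * radius S}"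

definition rights :: "pt set \<Rightarrow> sample \<Rightarrow> pt set" where
  "rights S s = {c \<in> S. c (fst s) \<ge> med S (fst s) + (sign_of (snd (snd s)) - \<epsilon>) * sqrt (fst (snd s)) * radius S}"

text \<open>The transition uses the center set and \<open>x\<close> but not the cell, which is why
  the center sets alone form a Markov chain. Singletons are absorbing.\<close>

definition descend :: "pt set \<Rightarrow> sample \<Rightarrow> pt set" where
  "descend S s = (if card S \<ge> 2 \<and> lefts S s \<noteq> {} \<and> rights S s \<noteq> {}
     then (if x (fst s) \<le> cut S s then lefts S s else rights S s) else S)"

definition expect :: "pt set \<Rightarrow> (pt set \<Rightarrow> real) \<Rightarrow> real" where
  "expect S g = (\<integral>s. g (descend S s) \<partial>M)"

abbreviation "groups \<equiv> Pow C - {{}}"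

lemma finite_groups: "finite groups" and countable_groups: "countable groups"
  using finite_C by (auto intro: countable_finite)

lemma finite_group: "S \<in> groups \<Longrightarrow> finite S"
  using finite_C finite_subset by auto

lemma descend_subset: "descend S s \<subseteq> S"
  by (auto simp: descend_def lefts_def rights_def)

lemma descend_nonempty: "S \<noteq> {} \<Longrightarrow> descend S s \<noteq> {}"
  by (auto simp: descend_def)

lemma descend_groups: "S \<in> groups \<Longrightarrow> descend S s \<in> groups"
  using descend_subset[of S s] descend_nonempty[of S s] by blast

section \<open>Measurability and expectation of one step\<close>

lemma measurable_selection:
  assumes "S \<in> groups" and [measurable]: "\<And>c. c \<in> S \<Longrightarrow> Measurable.pred N (P c)"
  shows "(\<lambda>s. {c \<in> S. P c s}) \<in> N \<rightarrow>\<^sub>M count_space (Pow C)"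
proof -
  have "(\<lambda>s. {c \<in> S. P c s}) -` {T} \<inter> space N \<in> sets N" for T
  proof -
    have "(\<lambda>s. {c \<in> S. P c s}) -` {T} \<inter> space N = (if T \<subseteq> S then {s \<in> space N. \<forall>c\<in>S. P c s \<longleftrightarrow> c \<in> T} else {})"
      by auto
    also have "\<dots> \<in> sets N"
      using finite_group[OF \<open>S \<in> groups\<close>] by auto
    finally show ?thesis .
  qed
  then show ?thesis
    using finite_C \<open>S \<in> groups\<close> by (subst measurable_count_space_eq2) auto
qed

lemma measurable_sample: "measurable M N = measurable (count_space UNIV \<Otimes>\<^sub>M (borel \<Otimes>\<^sub>M count_space UNIV)) N"
  by (rule measurable_cong_sets[OF sets_sample_measure refl])

lemma measurable_sample_coord: "(\<lambda>s. g (fst s)) \<in> borel_measurable M"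
  unfolding measurable_sample
  by (rule measurable_compose[OF measurable_fst]) simp

lemma measurable_sample_theta [measurable]: "(\<lambda>s. fst (snd s)) \<in> borel_measurable M"
  unfolding measurable_sample
  by (rule measurable_compose[OF measurable_snd measurable_fst])

lemma measurable_sample_sign [measurable]: "(\<lambda>s. sign_of (snd (snd s))) \<in> borel_measurable M"
  unfolding measurable_sample
  by (rule measurable_compose[OF measurable_snd measurable_compose[OF measurable_snd]]) simp

lemma measurable_lefts:
  assumes "S \<in> groups" shows "lefts S \<in> M \<rightarrow>\<^sub>M count_space (Pow C)"
  unfolding lefts_def[abs_def]
proof (rule measurable_selection[OF assms])
  fix c note [measurable] = measurable_sample_coord[of c] measurable_sample_coord[of "med S"]
  show "Measurable.pred M (\<lambda>s. c (fst s) \<le> med S (fst s) + (sign_of (snd (snd s)) + \<epsilon>) * sqrt (fst (snd s)) * radius S)"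
    by measurable
qed

lemma measurable_rights:
  assumes "S \<in> groups" shows "rights S \<in> M \<rightarrow>\<^sub>M count_space (Pow C)"
  unfolding rights_def[abs_def]
proof (rule measurable_selection[OF assms])
  fix c note [measurable] = measurable_sample_coord[of c] measurable_sample_coord[of "med S"]
  show "Measurable.pred M (\<lambda>s. c (fst s) \<ge> med S (fst s) + (sign_of (snd (snd s)) - \<epsilon>) * sqrt (fst (snd s)) * radius S)"
    by measurable
qed

lemma measurable_descend: 
  assumes S: "S \<in> groups"
  shows "descend S \<in> M \<rightarrow>\<^sub>M count_space groups"
proof -
  note [measurable] = measurable_lefts[OF S] measurable_rights[OF S]
    measurable_sample_coord[of x] measurable_sample_coord[of "med S"]
  have [measurable]: "Measurable.pred M (\<lambda>s. lefts S s \<noteq> {})" "Measurable.pred M (\<lambda>s. rights S s \<noteq> {})"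
    using measurable_compose[OF measurable_lefts[OF S], of "\<lambda>T. T \<noteq> {}" "count_space UNIV"]
      measurable_compose[OF measurable_rights[OF S], of "\<lambda>T. T \<noteq> {}" "count_space UNIV"]
    by (simp_all add: measurable_count_space_eq1)
  have [measurable]: "cut S \<in> borel_measurable M"
    unfolding cut_def[abs_def] by measurable
  have p: "Measurable.pred M (\<lambda>s. card S \<ge> 2 \<and> lefts S s \<noteq> {} \<and> rights S s \<noteq> {})"
    "Measurable.pred M (\<lambda>s. x (fst s) \<le> cut S s)"
    by measurable
  have m: "descend S \<in> M \<rightarrow>\<^sub>M count_space (Pow C)"
    unfolding descend_def[abs_def]
    by (intro measurable_If measurable_lefts[OF S] measurable_rights[OF S]) (use S p in \<open>auto simp: pred_def\<close>)
  have "descend S -` {T} \<inter> space M \<in> sets M" if "T \<in> groups" for T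
    by (rule measurable_sets[OF m]) (use that in auto)
  then show ?thesis
    using finite_groups descend_groups[OF S] by (subst measurable_count_space_eq2) auto
qed

lemma integrable_descend:
  assumes S: "S \<in> groups"
  shows "integrable M (\<lambda>s. g (descend S s) :: real)"
proof (rule M.integrable_const_bound)
  show "AE s in M. norm (g (descend S s)) \<le> Max ((\<lambda>T. \<bar>g T\<bar>) ` groups)"
    using descend_groups[OF S] finite_groups by (intro AE_I2) auto
  show "(\<lambda>s. g (descend S s)) \<in> borel_measurable M"
    by (rule measurable_compose[OF measurable_descend[OF S]]) auto
qed

context
  fixes S assumes S: "S \<in> groups"
begin

lemma expect_add: "expect S (\<lambda>T. g T + h T) = expect S g + expect S h"
  unfolding expect_def by (rule Bochner_Integration.integral_add; rule integrable_descend[OF S])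

lemma expect_sum: "expect S (\<lambda>T. \<Sum>i\<in>I. g i T) = (\<Sum>i\<in>I. expect S (g i))"
  unfolding expect_def by (rule Bochner_Integration.integral_sum; rule integrable_descend[OF S])

lemma expect_cmult: "expect S (\<lambda>T. a * g T) = a * expect S g"
  unfolding expect_def by simp

lemma expect_const [simp]: "expect S (\<lambda>T. a) = a"
  unfolding expect_def using M.prob_space by simp

lemma expect_mono:
  assumes "\<And>T. T \<subseteq> S \<Longrightarrow> T \<noteq> {} \<Longrightarrow> g T \<le> h T"
  shows "expect S g \<le> expect S h"
  unfolding expect_def
  using assms descend_subset descend_nonempty S
  by (intro integral_mono integrable_descend) auto

lemma expect_le_const: "(\<And>T. T \<subseteq> S \<Longrightarrow> T \<noteq> {} \<Longrightarrow> g T \<le> a) \<Longrightarrow> expect S g \<le> a"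
  using expect_mono[of g "\<lambda>_. a"] by simp

lemma sets_descend: "{s. P (descend S s)} \<in> sets M"
proof -
  have "descend S -` {T \<in> groups. P T} \<inter> space M \<in> sets M"
    by (rule measurable_sets[OF measurable_descend[OF S]]) auto
  also have "descend S -` {T \<in> groups. P T} \<inter> space M = {s. P (descend S s)}"
    using descend_groups[OF S] by auto
  finally show ?thesis .
qed

lemma expect_of_bool: "expect S (\<lambda>T. of_bool (P T)) = measure M {s. P (descend S s)}"
proof -
  have "expect S (\<lambda>T. of_bool (P T)) = (\<integral>s. indicator {s. P (descend S s)} s \<partial>M)"
    unfolding expect_def by (intro Bochner_Integration.integral_cong) (auto simp: indicator_def)
  then show ?thesis using sets_descend by simp
qed

end

text \<open>The type of samples admits every index and every real \<open>\<theta>\<close>; the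
  values outside the intended ranges form a null set.\<close>

lemma AE_sample: "AE s in M. 0 < fst (snd s) \<and> fst (snd s) < 1 \<and> fst s < d"
proof -
  let ?N = "{s :: sample. \<not> (0 < fst (snd s) \<and> fst (snd s) < 1 \<and> fst s < d)}"
  note [measurable] = measurable_sample_coord[of real]
  have m: "Measurable.pred M (\<lambda>s. \<not> (0 < fst (snd s) \<and> fst (snd s) < 1 \<and> real (fst s) < real d))"
    by measurable
  then have N: "?N \<in> sets M" by (simp add: pred_def)
  have "emeasure M ?N = (\<integral>\<^sup>+s. indicator ?N s \<partial>M)" using N by simp
  also have "\<dots> = 0"
  proof -
    have "(\<integral>\<^sup>+\<theta>. (indicator ?N (i, \<theta>, True) + indicator ?N (i, \<theta>, False)) / 2 * indicator {0<..<1} \<theta> \<partial>lborel)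
        = (\<integral>\<^sup>+\<theta>. 0 \<partial>(lborel :: real measure))" if "i < d" for i
      by (rule nn_integral_cong) (use that in \<open>auto simp: indicator_def\<close>)
    then show ?thesis
      using N by (subst nn_integral_sample_measure[OF d]) auto
  qed
  finally have "emeasure M ?N = 0" .
  then show ?thesis
    using N by (intro AE_I[of _ _ ?N]) auto
qed

end

section \<open>Lebesgue measure of preimages under threshold maps\<close>

lemma emeasure_affine_vimage:
  fixes Y :: "real set"
  assumes [measurable]: "Y \<in> sets borel" and "a > 0"
  shows "ennreal a * emeasure lborel {z. t + a * z \<in> Y} = emeasure lborel Y"
proof -
  have "emeasure lborel Y = (\<integral>\<^sup>+y. indicator Y y \<partial>lborel)" by simp
  also have "\<dots> = ennreal a * (\<integral>\<^sup>+z. indicator Y (t + a * z) \<partial>lborel)"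
    using \<open>a > 0\<close> by (subst nn_integral_real_affine[where c=a and t=t]) auto
  also have "(\<integral>\<^sup>+z. indicator Y (t + a * z) \<partial>lborel) = (\<integral>\<^sup>+z. indicator {z. t + a * z \<in> Y} z \<partial>lborel)"
    by (intro nn_integral_cong) (auto simp: indicator_def)
  also have "\<dots> = emeasure lborel {z. t + a * z \<in> Y}"
    by (rule nn_integral_indicator) measurable
  finally show ?thesis by simp
qed

text \<open>On either side of 0 the map is affine, with slope \<open>(1 + \<eta>) * R\<close> or
  \<open>(1 - \<eta>) * R\<close>, both at least \<open>R / 2\<close>. The two halves land on
  opposite sides of \<open>m\<close>, so their parts of \<open>Y\<close> are disjoint and no factor
  2 is lost.\<close>

lemma emeasure_tilted_vimage_le:
  fixes Y :: "real set"
  assumes [measurable]: "Y \<in> sets borel" and "R > 0" "\<bar>\<eta>\<bar> \<le> 1 / 2"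
  shows "ennreal (R / 2) * emeasure lborel {z. m + z * R + \<eta> * \<bar>z\<bar> * R \<in> Y} \<le> emeasure lborel Y"
proof -
  let ?P = "{z. m + ((1 + \<eta>) * R) * z \<in> Y \<inter> {m<..}}" and ?N = "{z. m + ((1 - \<eta>) * R) * z \<in> Y \<inter> {..<m}}"
  have [measurable]: "?P \<in> sets borel" "?N \<in> sets borel" by measurable
  have pos: "(1 + \<eta>) * R > 0" "(1 - \<eta>) * R > 0" "R / 2 \<le> (1 + \<eta>) * R" "R / 2 \<le> (1 - \<eta>) * R"
    using assms by (auto simp: abs_le_iff)
  have "emeasure lborel {z. m + z * R + \<eta> * \<bar>z\<bar> * R \<in> Y} \<le> emeasure lborel ((?P \<union> ?N) \<union> {0})"
  proof (rule emeasure_mono)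
    show "{z. m + z * R + \<eta> * \<bar>z\<bar> * R \<in> Y} \<subseteq> (?P \<union> ?N) \<union> {0}"
    proof
      fix z assume z: "z \<in> {z. m + z * R + \<eta> * \<bar>z\<bar> * R \<in> Y}"
      consider "z > 0" | "z = 0" | "z < 0" by linarith
      then show "z \<in> (?P \<union> ?N) \<union> {0}"
      proof cases
        case 1
        then have "((1 + \<eta>) * R) * z > 0" by (rule mult_pos_pos[OF pos(1)])
        then show ?thesis using z 1 by (simp add: algebra_simps)
      next
        case 3
        then have "((1 - \<eta>) * R) * z < 0" by (rule mult_pos_neg[OF pos(2)])
        then show ?thesis using z 3 by (simp add: algebra_simps)
      qed simp
    qed
  qed simp
  also have "\<dots> \<le> emeasure lborel ?P + emeasure lborel ?N + emeasure lborel {0::real}"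
    by (intro order_trans[OF emeasure_subadditive] add_mono) auto
  also have "\<dots> = emeasure lborel ?P + emeasure lborel ?N" by simp
  finally have "ennreal (R / 2) * emeasure lborel {z. m + z * R + \<eta> * \<bar>z\<bar> * R \<in> Y}
     \<le> ennreal (R / 2) * emeasure lborel ?P + ennreal (R / 2) * emeasure lborel ?N"
    by (simp add: mult_left_mono distrib_left[symmetric])
  also have "\<dots> \<le> ennreal ((1 + \<eta>) * R) * emeasure lborel ?P + ennreal ((1 - \<eta>) * R) * emeasure lborel ?N"
    using pos by (intro add_mono mult_right_mono ennreal_leI) auto
  also have "\<dots> = emeasure lborel (Y \<inter> {m<..}) + emeasure lborel (Y \<inter> {..<m})"
    using pos by (simp only: emeasure_affine_vimage[OF sets.Int[OF assms(1) greaterThan_borel]]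
      emeasure_affine_vimage[OF sets.Int[OF assms(1) lessThan_borel]])
  also have "\<dots> = emeasure lborel (Y \<inter> {m<..} \<union> Y \<inter> {..<m})"
    by (rule plus_emeasure) auto
  also have "\<dots> \<le> emeasure lborel Y"
    by (rule emeasure_mono) auto
  finally show ?thesis .
qed

lemma abs_sign_of_mult [simp]: "\<bar>sign_of b * t\<bar> = \<bar>t\<bar>"
  by (simp add: sign_of_def)

section \<open>Medians, radius and reach\<close>

context threshold_tree
begin

lemma dist_le_radius: "S \<in> groups \<Longrightarrow> c \<in> S \<Longrightarrow> dist_d d c (med S) \<le> radius S"
  unfolding radius_def using finite_group[of S] by (intro Max_ge finite_imageI imageI)

lemma dist_le_reach: "S \<in> groups \<Longrightarrow> c \<in> S \<Longrightarrow> dist_d d x c \<le> reach S"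
  unfolding reach_def using finite_group[of S] by (intro Max_ge finite_imageI imageI)

lemma reach_attained: "S \<in> groups \<Longrightarrow> \<exists>c\<in>S. reach S = dist_d d x c"
proof -
  assume "S \<in> groups"
  then have "Max (dist_d d x ` S) \<in> dist_d d x ` S"
    using finite_group[of S] by (intro Max_in) auto
  then show ?thesis unfolding reach_def by (rule imageE) blast
qed

lemma reach_mono: "S \<in> groups \<Longrightarrow> T \<subseteq> S \<Longrightarrow> T \<noteq> {} \<Longrightarrow> reach T \<le> reach S"
  unfolding reach_def using finite_group[of S] by (intro Max_mono) auto

lemma reach_nonneg: "S \<in> groups \<Longrightarrow> 0 \<le> reach S"
  using reach_attained[of S] by (metis dist_d_nonneg)

lemma card_beyond_median:
  assumes "S \<in> groups" "i < d"
  shows "2 * card {c \<in> S. c i < med S i} \<le> card S" "2 * card {c \<in> S. c i > med S i} \<le> card S"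
  using median[of S] assms unfolding is_median_def by (auto simp: field_simps)

lemma card_up_to_median:
  assumes "S \<in> groups" "i < d"
  shows "card S \<le> 2 * card {c \<in> S. c i \<le> med S i}" "card S \<le> 2 * card {c \<in> S. c i \<ge> med S i}"
proof -
  have "card {c \<in> S. c i \<le> med S i} + card {c \<in> S. c i > med S i} = card S"
    using finite_group[OF assms(1)] by (subst card_Un_disjoint[symmetric]) (auto intro!: arg_cong[where f=card])
  moreover have "card {c \<in> S. c i \<ge> med S i} + card {c \<in> S. c i < med S i} = card S"
    using finite_group[OF assms(1)] by (subst card_Un_disjoint[symmetric]) (auto intro!: arg_cong[where f=card])
  ultimately show "card S \<le> 2 * card {c \<in> S. c i \<le> med S i}" "card S \<le> 2 * card {c \<in> S. c i \<ge> med S i}"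
    using card_beyond_median[OF assms] by linarith+
qed

lemma exists_up_to_median:
  assumes "S \<in> groups" "i < d"
  shows "\<exists>c\<in>S. c i \<le> med S i" "\<exists>c\<in>S. c i \<ge> med S i"
proof -
  have "card S > 0" using assms finite_group[OF assms(1)] by (auto simp: card_gt_0_iff)
  then have "card {c \<in> S. c i \<le> med S i} > 0" "card {c \<in> S. c i \<ge> med S i} > 0"
    using card_up_to_median[OF assms] by linarith+
  then show "\<exists>c\<in>S. c i \<le> med S i" "\<exists>c\<in>S. c i \<ge> med S i"
    by (auto simp: card_gt_0_iff)
qed

lemma radius_pos:
  assumes S: "S \<in> groups" and "card S \<ge> 2"
  shows "radius S > 0"
proof (rule ccontr)
  assume "\<not> radius S > 0"
  have eq: "c i = med S i" if "c \<in> S" "i < d" for c i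
    using dist_le_radius[OF S that(1)] abs_coord_le_dist_d[OF that(2), of c "med S"] \<open>\<not> radius S > 0\<close> by simp
  have "c = c'" if "c \<in> S" "c' \<in> S" for c c'
  proof
    fix i show "c i = c' i"
      using eq[of c i] eq[of c' i] vanish[of c i] vanish[of c' i] that S by (cases "i < d") (auto simp: subset_iff)
  qed
  then have "card S \<le> 1"
    by (metis card_le_Suc0_iff_eq S finite_group One_nat_def)
  then show False using \<open>card S \<ge> 2\<close> by simp
qed

text \<open>At least half of the centers lie at the median or on its side away from
  \<open>x\<close>; in coordinate \<open>i\<close> these are at least as far from \<open>x\<close>
  as the median is.\<close>

lemma coord_median_le:
  assumes S: "S \<in> groups" and i: "i < d"
  shows "card S * (x i - med S i)\<^sup>2 \<le> 2 * (\<Sum>c\<in>S. (x i - c i)\<^sup>2)"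
proof -
  define A where "A = (if x i \<ge> med S i then {c \<in> S. c i \<le> med S i} else {c \<in> S. c i \<ge> med S i})"
  have A: "A \<subseteq> S" "card S \<le> 2 * card A"
    using card_up_to_median[OF S i] by (auto simp: A_def)
  have "(x i - med S i)\<^sup>2 \<le> (x i - c i)\<^sup>2" if "c \<in> A" for c
    unfolding abs_le_square_iff[symmetric] using that by (auto simp: A_def split: if_splits)
  then have "card A * (x i - med S i)\<^sup>2 \<le> (\<Sum>c\<in>A. (x i - c i)\<^sup>2)"
    by (intro sum_bounded_below)
  also have "\<dots> \<le> (\<Sum>c\<in>S. (x i - c i)\<^sup>2)"
    using A finite_group[OF S] by (intro sum_mono2) auto
  finally have "2 * card A * (x i - med S i)\<^sup>2 \<le> 2 * (\<Sum>c\<in>S. (x i - c i)\<^sup>2)" by simp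
  moreover have "card S * (x i - med S i)\<^sup>2 \<le> real (2 * card A) * (x i - med S i)\<^sup>2"
    using A(2) by (intro mult_right_mono) (auto simp del: of_nat_mult)
  ultimately show ?thesis by simp
qed

text \<open>Summing the coordinate bound over \<open>i\<close> compares the median with the average
  squared distance of the centers, which is at most \<open>(reach S)\<^sup>2\<close>. The median
  itself need not be near any single center.\<close>

lemma dist_median_le:
  assumes S: "S \<in> groups"
  shows "dist_d d x (med S) \<le> 2 * reach S"
proof -
  have pos: "card S > 0" using S finite_group[OF S] by (auto simp: card_gt_0_iff)
  have "card S * (dist_d d x (med S))\<^sup>2 = (\<Sum>i<d. card S * (x i - med S i)\<^sup>2)"
    by (simp add: dist_d_power2 sum_distrib_left)
  also have "\<dots> \<le> (\<Sum>i<d. 2 * (\<Sum>c\<in>S. (x i - c i)\<^sup>2))"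
    by (intro sum_mono coord_median_le[OF S]) auto
  also have "\<dots> = 2 * (\<Sum>c\<in>S. (dist_d d x c)\<^sup>2)"
    by (simp add: dist_d_power2 sum_distrib_left sum.swap[of _ S])
  also have "\<dots> \<le> 2 * (card S * (reach S)\<^sup>2)"
    by (intro mult_left_mono sum_bounded_above power_mono dist_le_reach[OF S]) auto
  finally have "card S * (dist_d d x (med S))\<^sup>2 \<le> card S * (2 * (reach S)\<^sup>2)" by simp
  then have "(dist_d d x (med S))\<^sup>2 \<le> 2 * (reach S)\<^sup>2"
    using pos by (subst (asm) mult_le_cancel_left_pos) auto
  also have "\<dots> \<le> (2 * reach S)\<^sup>2" by (simp add: power_mult_distrib)
  finally show ?thesis by (rule power2_le_imp_le) (simp add: reach_nonneg[OF S])
qed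

lemma radius_le_reach:
  assumes S: "S \<in> groups"
  shows "radius S \<le> 3 * reach S"
  unfolding radius_def
proof (subst Max_le_iff; safe?)
  fix c assume "c \<in> S"
  then show "dist_d d c (med S) \<le> 3 * reach S"
    using dist_d_triangle[of d c "med S" x] dist_le_reach[OF S, of c] dist_median_le[OF S]
    by (simp add: dist_d_commute)
qed (use S finite_group[OF S] in auto)

text \<open>A center close to \<open>x\<close> and the farthest one are at least
  \<open>7/8 * reach S\<close> apart, yet both lie within \<open>radius S\<close> of the median.
  Without a close center the set could be a tight cluster far from \<open>x\<close>.\<close>

lemma reach_le_radius:
  assumes S: "S \<in> groups" and c: "c \<in> S" "8 * dist_d d x c \<le> reach S"
  shows "reach S \<le> 4 * radius S"
proof -
  obtain e where e: "e \<in> S" "reach S = dist_d d x e" using reach_attained[OF S] by blast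
  have "dist_d d x e \<le> dist_d d x c + (dist_d d c (med S) + dist_d d (med S) e)"
    using dist_d_triangle[of d x e c] dist_d_triangle[of d c e "med S"] by linarith
  also have "\<dots> \<le> reach S / 8 + (radius S + radius S)"
    using dist_le_radius[OF S c(1)] dist_le_radius[OF S e(1)] c(2) by (simp add: dist_d_commute)
  finally show ?thesis using e dist_d_nonneg[of d x e] by linarith
qed

section \<open>Losing or separating centers in one round\<close>

lemma measure_threshold_le:
  assumes Z: "\<And>i. Z i \<in> sets borel" and q: "\<And>i z. i < d \<Longrightarrow> z \<in> Z i \<Longrightarrow> \<bar>z\<bar> \<le> q i"
    and l: "\<And>i. i < d \<Longrightarrow> emeasure lborel (Z i) \<le> ennreal (l i)" 
    and nn: "\<And>i. i < d \<Longrightarrow> 0 \<le> q i" "\<And>i. i < d \<Longrightarrow> 0 \<le> l i"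
  shows "measure M {(i, \<theta>, b). sign_of b * sqrt \<theta> \<in> Z i} \<le> (\<Sum>i<d. q i * l i) / d"
proof -
  have "emeasure M {(i, \<theta>, b). sign_of b * sqrt \<theta> \<in> Z i} \<le> (\<Sum>i<d. ennreal (q i) * emeasure lborel (Z i)) / d"
    by (rule emeasure_threshold_le(1)[OF d Z q])
  also have "\<dots> \<le> (\<Sum>i<d. ennreal (q i) * ennreal (l i)) / d"
    using l by (intro divide_right_mono_ennreal sum_mono mult_left_mono) auto
  also have "\<dots> = (\<Sum>i<d. ennreal (q i * l i)) / d"
    by (intro arg_cong2[where f="(/)"] sum.cong) (auto simp: ennreal_mult nn)
  also have "\<dots> = ennreal ((\<Sum>i<d. q i * l i) / d)"
  proof -
    have "0 \<le> (\<Sum>i<d. q i * l i)" using nn by (intro sum_nonneg) auto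
    then show ?thesis
      using d nn by (subst sum_ennreal) (auto simp: divide_ennreal ennreal_of_nat_eq_real_of_nat)
  qed
  finally show ?thesis
    using nn by (subst (asm) M.emeasure_eq_measure, subst (asm) ennreal_le_iff) (auto intro!: sum_nonneg divide_nonneg_nonneg)
qed

text \<open>A lost center is separated from \<open>x\<close> by the cut. In coordinate
  \<open>i\<close> this needs a threshold in an interval of length \<open>l i\<close>, where the
  density is at most \<open>q i\<close>. With \<open>\<delta>\<close> the distance of
  \<open>e\<close> and \<open>R\<close> the radius, Cauchy-Schwarz bounds the sum of
  \<open>q i * l i\<close> by \<open>\<delta>/R * (1 + \<delta>/R)\<close>, and
  \<open>\<delta> \<le> reach S \<le> 4 * R\<close> yields 20 = 4 * 5.\<close>

lemma expect_lose_le: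
  assumes S: "S \<in> groups" and e: "e \<in> S" and reach: "0 < reach S" "reach S \<le> 4 * radius S"
  shows "expect S (\<lambda>T. of_bool (e \<notin> T)) \<le> 20 * dist_d d x e / (d * reach S)"
proof -
  let ?R = "radius S" and ?\<delta> = "dist_d d x e"
  have R: "?R > 0" using reach by linarith
  define Z where "Z i = {z. x i \<le> med S i + z * ?R \<and> med S i + z * ?R \<le> e i
     \<or> e i \<le> med S i + z * ?R \<and> med S i + z * ?R \<le> x i}" for i
  define q where "q i = (\<bar>e i - med S i\<bar> + \<bar>x i - e i\<bar>) / ?R" for i
  define l where "l i = \<bar>x i - e i\<bar> / ?R" for i
  have Z_eq: "Z i = {(x i - med S i) / ?R..(e i - med S i) / ?R} \<union> {(e i - med S i) / ?R..(x i - med S i) / ?R}" for i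
    using R by (auto simp: Z_def field_simps)
  \<comment> \<open>The sharing margin only enlarges both children, so a lost \<open>e\<close> lies
    across the unshifted cut from \<open>x\<close>.\<close>
  have event: "sign_of b * sqrt \<theta> \<in> Z i" if "0 < \<theta>" "e \<notin> descend S (i, \<theta>, b)" for i \<theta> b
  proof -
    have "0 \<le> \<epsilon> * sqrt \<theta> * ?R" using that R eps_pos by simp
    then show ?thesis
      using that(2) e by (auto simp: descend_def lefts_def rights_def cut_def Z_def algebra_simps split: if_splits)
  qed
  have "expect S (\<lambda>T. of_bool (e \<notin> T)) = measure M {s. e \<notin> descend S s}"
    by (rule expect_of_bool[OF S])
  also have "\<dots> \<le> measure M {(i, \<theta>, b). sign_of b * sqrt \<theta> \<in> Z i}"
  proof (rule M.finite_measure_mono_AE)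
    show "AE s in M. s \<in> {s. e \<notin> descend S s} \<longrightarrow> s \<in> {(i, \<theta>, b). sign_of b * sqrt \<theta> \<in> Z i}"
      using AE_sample by eventually_elim (auto dest: event)
    show "{(i, \<theta>, b). sign_of b * sqrt \<theta> \<in> Z i} \<in> sets M"
      by (rule emeasure_threshold_le(2)[OF d, where q="\<lambda>i. q i"]; (unfold Z_eq)?)
        (use R in \<open>auto simp: q_def field_simps abs_le_iff\<close>)
  qed
  also have "\<dots> \<le> (\<Sum>i<d. q i * l i) / d"
  proof (rule measure_threshold_le)
    show "\<bar>z\<bar> \<le> q i" if "z \<in> Z i" for i z
    proof -
      have "\<bar>z * ?R\<bar> \<le> \<bar>e i - med S i\<bar> + \<bar>x i - e i\<bar>" using that by (auto simp: Z_def)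
      then show ?thesis using R by (simp add: q_def field_simps abs_mult)
    qed
    show "emeasure lborel (Z i) \<le> ennreal (l i)" for i
    proof (cases "x i \<le> e i")
      case True
      then have "Z i \<subseteq> {(x i - med S i) / ?R..(e i - med S i) / ?R}"
        using R by (auto simp: Z_def field_simps)
      then have "emeasure lborel (Z i) \<le> emeasure lborel {(x i - med S i) / ?R..(e i - med S i) / ?R}"
        by (rule emeasure_mono) simp
      also have "\<dots> = ennreal (l i)"
        using True R by (subst emeasure_lborel_Icc) (auto simp: l_def field_simps)
      finally show ?thesis .
    next
      case False
      then have "Z i \<subseteq> {(e i - med S i) / ?R..(x i - med S i) / ?R}"
        using R by (auto simp: Z_def field_simps)
      then have "emeasure lborel (Z i) \<le> emeasure lborel {(e i - med S i) / ?R..(x i - med S i) / ?R}"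
        by (rule emeasure_mono) simp
      also have "\<dots> = ennreal (l i)"
        using False R by (subst emeasure_lborel_Icc) (auto simp: l_def field_simps)
      finally show ?thesis .
    qed
  qed (use R in \<open>auto simp: Z_eq q_def l_def\<close>)
  also have "(\<Sum>i<d. q i * l i) = ((\<Sum>i<d. \<bar>e i - med S i\<bar> * \<bar>x i - e i\<bar>) + (\<Sum>i<d. (x i - e i)\<^sup>2)) / ?R\<^sup>2"
    by (simp add: q_def l_def sum.distrib[symmetric] sum_divide_distrib power2_eq_square abs_mult_self distrib_right)
  also have "\<dots> \<le> (?R * ?\<delta> + ?\<delta>\<^sup>2) / ?R\<^sup>2"
  proof (intro divide_right_mono add_mono)
    have "(\<Sum>i<d. \<bar>e i - med S i\<bar> * \<bar>x i - e i\<bar>) \<le> dist_d d e (med S) * ?\<delta>"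
      using L2_set_mult_ineq[of "\<lambda>i. e i - med S i" "\<lambda>i. x i - e i" "{..<d}"] by (simp add: dist_d_L2_set)
    also have "\<dots> \<le> ?R * ?\<delta>" by (intro mult_right_mono dist_le_radius[OF S e]) simp
    finally show "(\<Sum>i<d. \<bar>e i - med S i\<bar> * \<bar>x i - e i\<bar>) \<le> ?R * ?\<delta>" .
  qed (simp_all add: dist_d_power2)
  also have "\<dots> = ?\<delta> / ?R * (1 + ?\<delta> / ?R)"
    using R by (simp add: field_simps power2_eq_square)
  also have "\<dots> \<le> (4 * ?\<delta> / reach S) * 5"
  proof (intro mult_mono)
    have "reach S * ?\<delta> \<le> 4 * radius S * ?\<delta>" using reach by (intro mult_right_mono) auto
    then show "?\<delta> / ?R \<le> 4 * ?\<delta> / reach S" using R reach by (simp add: field_simps)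
    have "?\<delta> \<le> 4 * ?R" using dist_le_reach[OF S e] reach by linarith
    then show "1 + ?\<delta> / ?R \<le> 5" using R by (simp add: field_simps)
  qed (use R reach in auto)
  finally show ?thesis
    using d by (simp add: divide_right_mono field_simps)
qed


text \<open>Aim the sign at \<open>e\<close> and stop the threshold short of \<open>e\<close>. The
  child that keeps \<open>e\<close> then lies strictly beyond the median and has at most half of the
  centers, while the other child has lost \<open>e\<close>; one of the two alternatives holds
  whichever child \<open>x\<close> enters. A center at the median or on its other side keeps both
  children nonempty and proper.\<close>

lemma exists_split_event:
  assumes S: "S \<in> groups" and "card S \<ge> 2" and e: "e \<in> S"
  shows "\<exists>E\<in>sets M. (dist_d d e (med S))\<^sup>2 / (4 * d * (radius S)\<^sup>2) \<le> measure M E \<and>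
    (\<forall>s\<in>E. {} \<subset> lefts S s \<and> lefts S s \<subset> S \<and> {} \<subset> rights S s \<and> rights S s \<subset> S \<and>
       (e \<notin> descend S s \<or> 2 * card (descend S s) \<le> card S))"
proof -
  let ?R = "radius S" and ?m = "med S"
  have R: "?R > 0" using radius_pos[OF S \<open>card S \<ge> 2\<close>] .
  \<comment> \<open>The factor \<open>1 + \<epsilon>\<close> puts \<open>e\<close> beyond the
    sharing margin, so that \<open>e\<close> goes to one child only. Its square is at most 2, which
    accounts for the 4 in the bound.\<close>
  define a where "a i = (if i < d then \<bar>e i - ?m i\<bar> / ((1 + \<epsilon>) * ?R) else 0)" for i
  let ?E = "{(i, \<theta>, b). b = (e i > ?m i) \<and> 0 < \<theta> \<and> \<theta> < (a i)\<^sup>2}"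
  have a: "0 \<le> a i \<and> a i \<le> 1" for i
  proof (cases "i < d")
    case True
    have "\<bar>e i - ?m i\<bar> \<le> (1 + \<epsilon>) * ?R"
      using abs_coord_le_dist_d[OF True, of e ?m] dist_le_radius[OF S e] R eps_pos
      by (simp add: distrib_right) (smt (verit) mult_pos_pos)
    then show ?thesis using R eps_pos by (simp add: a_def)
  qed (simp add: a_def)
  have event: "{} \<subset> lefts S s \<and> lefts S s \<subset> S \<and> {} \<subset> rights S s \<and> rights S s \<subset> S \<and>
       (e \<notin> descend S s \<or> 2 * card (descend S s) \<le> card S)"
    if s: "s = (i, \<theta>, b)" and b: "b = (e i > ?m i)" and \<theta>: "0 < \<theta>" "\<theta> < (a i)\<^sup>2" for s i \<theta> b
  proof -
    have i: "i < d" using \<theta> by (auto simp: a_def split: if_splits)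
    have "sqrt \<theta> < a i"
      using real_sqrt_less_mono[OF \<theta>(2)] a[of i] by simp
    then have t: "(1 + \<epsilon>) * (sqrt \<theta> * ?R) < \<bar>e i - ?m i\<bar>"
    proof -
      have "(1 + \<epsilon>) * ?R > 0" using R eps_pos by simp
      with \<open>sqrt \<theta> < a i\<close> i have "sqrt \<theta> * ((1 + \<epsilon>) * ?R) < \<bar>e i - ?m i\<bar>"
        by (simp only: a_def pos_less_divide_eq if_True)
      then show ?thesis by (simp only: mult_ac)
    qed
    have tpos: "0 < sqrt \<theta> * ?R" "\<epsilon> * (sqrt \<theta> * ?R) > 0" using \<theta> R eps_pos by simp_all
    have lt: "\<epsilon> * (sqrt \<theta> * ?R) < sqrt \<theta> * ?R"
      using mult_strict_right_mono[OF _ tpos(1), of \<epsilon> 1] eps_le by simp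
    have sub: "lefts S s \<subseteq> S" "rights S s \<subseteq> S" by (auto simp: lefts_def rights_def)
    show ?thesis
    proof (cases b)
      case True
      then have eR: "e i > ?m i + (1 + \<epsilon>) * (sqrt \<theta> * ?R)" using t b by simp
      obtain c where c: "c \<in> S" "c i \<le> ?m i" using exists_up_to_median(1)[OF S i] by blast
      have L: "c \<in> lefts S s" "e \<notin> lefts S s"
        using c eR tpos True by (auto simp: s lefts_def sign_of_def algebra_simps)
      have Rt: "e \<in> rights S s" "rights S s \<subseteq> {c \<in> S. c i > ?m i}"
        using e eR tpos lt True by (auto simp: s rights_def sign_of_def algebra_simps)
      have "card (rights S s) \<le> card {c \<in> S. c i > ?m i}"
        using Rt finite_group[OF S] by (intro card_mono) auto
      then have "2 * card (rights S s) \<le> card S" using card_beyond_median(2)[OF S i] by linarith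
      moreover have "c \<notin> rights S s" using Rt c by auto
      ultimately show ?thesis using L Rt c e sub \<open>card S \<ge> 2\<close> by (auto simp: descend_def)
    next
      case False
      then have eR: "e i < ?m i - (1 + \<epsilon>) * (sqrt \<theta> * ?R)" using t b tpos by auto
      obtain c where c: "c \<in> S" "c i \<ge> ?m i" using exists_up_to_median(2)[OF S i] by blast
      have Rt: "c \<in> rights S s" "e \<notin> rights S s"
        using c eR tpos False by (auto simp: s rights_def sign_of_def algebra_simps)
      have L: "e \<in> lefts S s" "lefts S s \<subseteq> {c \<in> S. c i < ?m i}"
        using e eR tpos lt False by (auto simp: s lefts_def sign_of_def algebra_simps)
      have "card (lefts S s) \<le> card {c \<in> S. c i < ?m i}"
        using L finite_group[OF S] by (intro card_mono) auto
      then have "2 * card (lefts S s) \<le> card S" using card_beyond_median(1)[OF S i] by linarith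
      moreover have "c \<notin> lefts S s" using L c by auto
      ultimately show ?thesis using L Rt c e sub \<open>card S \<ge> 2\<close> by (auto simp: descend_def)
    qed
  qed
  have "(dist_d d e ?m)\<^sup>2 / (4 * d * ?R\<^sup>2) \<le> (dist_d d e ?m)\<^sup>2 / (2 * d * ((1 + \<epsilon>)\<^sup>2 * ?R\<^sup>2))"
  proof (intro divide_left_mono)
    have "(1 + \<epsilon>)\<^sup>2 \<le> (1 + 1 / 320)\<^sup>2" using eps_pos eps_le by (intro power_mono) auto
    also have "\<dots> \<le> 2" by (simp add: power2_eq_square)
    finally have "(1 + \<epsilon>)\<^sup>2 * ?R\<^sup>2 \<le> 2 * ?R\<^sup>2" by (intro mult_right_mono) auto
    then show "2 * d * ((1 + \<epsilon>)\<^sup>2 * ?R\<^sup>2) \<le> 4 * d * ?R\<^sup>2"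
      using d by simp
  qed (use d R eps_pos in auto)
  also have "\<dots> = (\<Sum>i<d. (a i)\<^sup>2) / (2 * d)"
    by (simp add: a_def dist_d_power2 power_divide power_mult_distrib sum_divide_distrib[symmetric] mult.commute)
  also have "\<dots> \<le> measure M ?E"
    using emeasure_threshold_ge(1)[OF d a, where sg="\<lambda>i. e i > ?m i"]
    by (simp add: M.emeasure_eq_measure)
  finally have prob: "(dist_d d e ?m)\<^sup>2 / (4 * d * ?R\<^sup>2) \<le> measure M ?E" .
  have all: "{} \<subset> lefts S s \<and> lefts S s \<subset> S \<and> {} \<subset> rights S s \<and> rights S s \<subset> S \<and>
       (e \<notin> descend S s \<or> 2 * card (descend S s) \<le> card S)" if "s \<in> ?E" for s
  proof -
    obtain i \<theta> b where s: "s = (i, \<theta>, b)" by (cases s)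
    show ?thesis using that event[OF s] unfolding s by simp
  qed
  have "?E \<in> sets M" by (rule emeasure_threshold_ge(2)[OF d a])
  with conjI[OF prob ballI[OF all]] show ?thesis by (rule bexI)
qed

lemma expect_progress_ge:
  assumes S: "S \<in> groups" and "card S \<ge> 2" and e: "e \<in> S"
  shows "(dist_d d e (med S))\<^sup>2 / (4 * d * (radius S)\<^sup>2)
    \<le> expect S (\<lambda>T. of_bool (e \<notin> T \<or> 2 * card T \<le> card S))"
proof -
  obtain E where E: "(dist_d d e (med S))\<^sup>2 / (4 * d * (radius S)\<^sup>2) \<le> measure M E"
    and "\<And>s. s \<in> E \<Longrightarrow> e \<notin> descend S s \<or> 2 * card (descend S s) \<le> card S"
    using exists_split_event[OF assms] by metis
  then have "measure M E \<le> measure M {s. e \<notin> descend S s \<or> 2 * card (descend S s) \<le> card S}"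
    by (intro M.finite_measure_mono sets_descend[OF S]) auto
  then show ?thesis
    using E unfolding expect_of_bool[OF S] by (rule order_trans[rotated])
qed

text \<open>When a cut in coordinate \<open>i\<close> separates \<open>x\<close> from \<open>c\<close> and \<open>c\<close> is not shared, the centers that stay
  with \<open>x\<close> are those on the near side of the shifted threshold \<open>y = \<xi> \<plusminus> \<epsilon> \<surd>\<theta> R\<close>, and \<open>y\<close> lies in
  \<open>slab c i\<close>.\<close>

definition side :: "pt \<Rightarrow> nat \<Rightarrow> real \<Rightarrow> pt set" where
  "side c i y = (if x i < c i then {e \<in> C. e i \<le> y} else {e \<in> C. y \<le> e i})"

text \<open>Open at \<open>c i\<close>, because a center exactly on the shifted threshold is
  kept.\<close>

definition slab :: "pt \<Rightarrow> nat \<Rightarrow> real set" where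
  "slab c i = (if x i < c i then {x i..<c i} else {c i<..x i})"

text \<open>The pattern \<open>P\<close> is taken among all centers and not in the current set, so
  that a portion stays the same while the chain runs; the survivors of \<open>S\<close> are
  \<open>S \<inter> P\<close>.\<close>

definition portion :: "pt \<Rightarrow> pt set \<Rightarrow> nat \<Rightarrow> real set" where
  "portion c P i = {y \<in> slab c i. side c i y = P}"

text \<open>The measure is the length of the positions with pattern \<open>P\<close>; the factor
  \<open>\<bar>x i - c i\<bar>\<close> comes from the bound on the threshold density in
  \<open>lost_group\<close>.\<close>

definition weight :: "pt \<Rightarrow> pt set \<Rightarrow> real" where
  "weight c P = (\<Sum>i<d. \<bar>x i - c i\<bar> * measure lborel (portion c P i))"

lemma sets_portion [measurable]: "portion c P i \<in> sets borel"
proof -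
  have "portion c P i = (if P \<subseteq> C then
      (if x i < c i then slab c i \<inter> {y. \<forall>e\<in>C. e i \<le> y \<longleftrightarrow> e \<in> P} else slab c i \<inter> {y. \<forall>e\<in>C. y \<le> e i \<longleftrightarrow> e \<in> P})
      else {})"
    by (auto simp: portion_def side_def)
  moreover have "{y. \<forall>e\<in>C. e i \<le> y \<longleftrightarrow> e \<in> P} \<in> sets borel" "{y. \<forall>e\<in>C. y \<le> e i \<longleftrightarrow> e \<in> P} \<in> sets borel"
    using finite_C by measurable
  moreover have "slab c i \<in> sets borel" by (simp add: slab_def)
  ultimately show ?thesis by auto
qed

lemma weight_nonneg: "0 \<le> weight c P"
  by (simp add: weight_def sum_nonneg)

lemma emeasure_slab: "emeasure lborel (slab c i) = ennreal \<bar>x i - c i\<bar>"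
  by (simp add: slab_def)

lemma emeasure_portion_finite: "emeasure lborel (portion c P i) \<noteq> \<infinity>"
proof -
  have "emeasure lborel (portion c P i) \<le> emeasure lborel (slab c i)"
    by (rule emeasure_mono) (auto simp: portion_def slab_def)
  then show ?thesis by (auto simp: emeasure_slab top_unique)
qed

text \<open>For each \<open>i\<close> the portions partition the slab, of length
  \<open>\<bar>x i - c i\<bar>\<close>. Hence distributing the loss over the many patterns costs
  nothing in total.\<close>

lemma sum_weight: "(\<Sum>P\<in>Pow C. weight c P) = (dist_d d x c)\<^sup>2"
proof -
  have inner: "(\<Sum>P\<in>Pow C. measure lborel (portion c P i)) = \<bar>x i - c i\<bar>" for i
  proof -
    have "(\<Sum>P\<in>Pow C. measure lborel (portion c P i)) = measure lborel (\<Union>P\<in>Pow C. portion c P i)"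
    proof (rule measure_finite_Union[symmetric])
      show "disjoint_family_on (\<lambda>P. portion c P i) (Pow C)"
        by (auto simp: disjoint_family_on_def portion_def)
    qed (use finite_C emeasure_portion_finite in auto)
    also have "(\<Union>P\<in>Pow C. portion c P i) = slab c i"
    proof
      have "y \<in> portion c (side c i y) i" "side c i y \<in> Pow C" if "y \<in> slab c i" for y
        using that by (simp_all add: portion_def side_def)
      then show "slab c i \<subseteq> (\<Union>P\<in>Pow C. portion c P i)" by blast
    qed (auto simp: portion_def)
    also have "measure lborel (slab c i) = \<bar>x i - c i\<bar>"
      by (simp add: measure_def emeasure_slab)
    finally show ?thesis .
  qed
  have "(\<Sum>P\<in>Pow C. weight c P) = (\<Sum>i<d. \<bar>x i - c i\<bar> * (\<Sum>P\<in>Pow C. measure lborel (portion c P i)))"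
    unfolding weight_def sum_distrib_left by (rule sum.swap)
  then show ?thesis unfolding dist_d_power2 by (simp add: inner power2_eq_square)
qed

text \<open>If \<open>x\<close> goes left and \<open>c\<close> is lost, then \<open>c\<close> lies
  beyond the cut by more than the margin \<open>\<epsilon> * sqrt \<theta> * radius S\<close>. So
  the margin fits between \<open>x i\<close> and \<open>c i\<close>, which bounds
  \<open>\<bar>z\<bar>\<close>, the density of the threshold: this is the gain from sharing. The
  other case is symmetric; in both, \<open>\<eta>\<close> shifts the threshold towards
  \<open>c\<close>.\<close>

lemma lost_group:
  assumes S: "S \<in> groups" and "c \<in> S" and lost: "c \<notin> descend S (i, \<theta>, b)" and "0 < \<theta>" and R: "radius S > 0"
  defines "\<eta> \<equiv> if x i < c i then \<epsilon> else - \<epsilon>" and "z \<equiv> sign_of b * sqrt \<theta>"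
  shows "med S i + z * radius S + \<eta> * \<bar>z\<bar> * radius S \<in> slab c i"
    and "\<bar>z\<bar> \<le> \<bar>x i - c i\<bar> / (\<epsilon> * radius S)"
    and "descend S (i, \<theta>, b) = S \<inter> side c i (med S i + z * radius S + \<eta> * \<bar>z\<bar> * radius S)"
proof -
  let ?R = "radius S"
  have z: "\<bar>z\<bar> = sqrt \<theta>" using \<open>0 < \<theta>\<close> by (simp add: z_def)
  have pos: "0 < \<epsilon> * sqrt \<theta> * ?R" using \<open>0 < \<theta>\<close> R eps_pos by simp
  have L: "lefts S (i, \<theta>, b) = {e \<in> S. e i \<le> med S i + z * ?R + \<epsilon> * sqrt \<theta> * ?R}"
    and Rt: "rights S (i, \<theta>, b) = {e \<in> S. e i \<ge> med S i + z * ?R - \<epsilon> * sqrt \<theta> * ?R}"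
    by (simp_all add: lefts_def rights_def z_def algebra_simps)
  have cut: "cut S (i, \<theta>, b) = med S i + z * ?R" by (simp add: cut_def z_def)
  have *: "med S i + z * ?R + \<eta> * \<bar>z\<bar> * ?R \<in> slab c i \<and> \<epsilon> * sqrt \<theta> * ?R \<le> \<bar>x i - c i\<bar> \<and>
    descend S (i, \<theta>, b) = S \<inter> side c i (med S i + z * ?R + \<eta> * \<bar>z\<bar> * ?R)"
  proof (cases "x i \<le> cut S (i, \<theta>, b)")
    case True
    then have d: "descend S (i, \<theta>, b) = lefts S (i, \<theta>, b)"
      using lost \<open>c \<in> S\<close> by (auto simp: descend_def split: if_splits)
    then have "med S i + z * ?R + \<epsilon> * sqrt \<theta> * ?R < c i"
      using lost \<open>c \<in> S\<close> by (auto simp: L)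
    moreover from this have "x i < c i" using True pos by (simp add: cut)
    ultimately show ?thesis
      using True pos S unfolding d by (auto simp: L cut \<eta>_def z slab_def side_def)
  next
    case False
    then have d: "descend S (i, \<theta>, b) = rights S (i, \<theta>, b)"
      using lost \<open>c \<in> S\<close> by (auto simp: descend_def split: if_splits)
    then have "c i < med S i + z * ?R - \<epsilon> * sqrt \<theta> * ?R"
      using lost \<open>c \<in> S\<close> by (auto simp: Rt)
    moreover from this have "\<not> x i < c i" using False pos by (simp add: cut)
    ultimately show ?thesis
      using False pos S unfolding d by (auto simp: Rt cut \<eta>_def z slab_def side_def)
  qed
  then show "med S i + z * ?R + \<eta> * \<bar>z\<bar> * ?R \<in> slab c i"
    and "descend S (i, \<theta>, b) = S \<inter> side c i (med S i + z * ?R + \<eta> * \<bar>z\<bar> * ?R)" by auto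
  have "0 < \<epsilon> * ?R" using eps_pos R by simp
  then show "\<bar>z\<bar> \<le> \<bar>x i - c i\<bar> / (\<epsilon> * ?R)"
    using * z by (simp add: pos_le_divide_eq mult_ac)
qed

text \<open>Loss with pattern \<open>P\<close> forces the threshold into \<open>Z P i\<close> and
  the new state to be \<open>S \<inter> P\<close>. The tilted change of variables bounds the length
  of \<open>Z P i\<close> by \<open>2 / radius S\<close> times that of the portion, and
  \<open>q i\<close> bounds the density; their product sums to a multiple of
  \<open>weight c P\<close>.\<close>

lemma expect_lost_le:
  assumes S: "S \<in> groups" and c: "c \<in> S" and R: "radius S > 0" and g: "\<And>T. T \<subseteq> S \<Longrightarrow> T \<noteq> {} \<Longrightarrow> 0 \<le> g T"
  shows "expect S (\<lambda>T. of_bool (c \<notin> T) * g T)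
    \<le> 2 / (d * \<epsilon> * (radius S)\<^sup>2) * (\<Sum>P\<in>Pow C. weight c P * (if S \<inter> P = {} then 0 else g (S \<inter> P)))"
proof -
  let ?R = "radius S" and ?\<Delta> = "\<lambda>i. \<bar>x i - c i\<bar>"
  \<comment> \<open>The default 0 is safe: a round never ends in the empty set, and nothing is
    assumed about \<open>g\<close> there.\<close>
  define G where "G P = (if S \<inter> P = {} then 0 else g (S \<inter> P))" for P
  have G: "0 \<le> G P" for P using g by (simp add: G_def)
  define \<eta> where "\<eta> i = (if x i < c i then \<epsilon> else - \<epsilon>)" for i
  define y where "y i z = med S i + z * ?R + \<eta> i * \<bar>z\<bar> * ?R" for i z
  define q where "q i = ?\<Delta> i / (\<epsilon> * ?R)" for i
  define Z where "Z P i = {z. \<bar>z\<bar> \<le> q i \<and> y i z \<in> portion c P i}" for P i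
  let ?E = "\<lambda>P. {(i, \<theta>, b). sign_of b * sqrt \<theta> \<in> Z P i}"
  have Z[measurable]: "Z P i \<in> sets borel" for P i
    unfolding Z_def y_def by measurable
  have Zq: "\<bar>z\<bar> \<le> q i" if "z \<in> Z P i" for z P i using that by (simp add: Z_def)
  have E: "?E P \<in> sets M" for P
    by (rule emeasure_threshold_le(2)[OF d, where q=q]) (use Zq in auto)
  have prob: "measure M (?E P) \<le> 2 / (d * \<epsilon> * ?R\<^sup>2) * weight c P" for P
  proof -
    have "measure M (?E P) \<le> (\<Sum>i<d. q i * (2 / ?R * measure lborel (portion c P i))) / d"
    proof (rule measure_threshold_le)
      show "emeasure lborel (Z P i) \<le> ennreal (2 / ?R * measure lborel (portion c P i))" for i
      proof -
        have "ennreal (?R / 2) * emeasure lborel (Z P i)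
          \<le> ennreal (?R / 2) * emeasure lborel {z. med S i + z * ?R + \<eta> i * \<bar>z\<bar> * ?R \<in> portion c P i}"
          by (intro mult_left_mono emeasure_mono) (auto simp: Z_def y_def)
        also have "\<dots> \<le> emeasure lborel (portion c P i)"
          using R eps_pos eps_le by (intro emeasure_tilted_vimage_le) (auto simp: \<eta>_def)
        finally have "ennreal (2 / ?R) * (ennreal (?R / 2) * emeasure lborel (Z P i))
            \<le> ennreal (2 / ?R) * emeasure lborel (portion c P i)"
          by (rule mult_left_mono) simp
        also have "ennreal (2 / ?R) * (ennreal (?R / 2) * emeasure lborel (Z P i)) = emeasure lborel (Z P i)"
          using R by (simp add: mult.assoc[symmetric] ennreal_mult[symmetric])
        also have "ennreal (2 / ?R) * emeasure lborel (portion c P i) = ennreal (2 / ?R * measure lborel (portion c P i))"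
          using R emeasure_portion_finite by (simp add: ennreal_mult[symmetric] emeasure_eq_ennreal_measure)
        finally show ?thesis .
      qed
    qed (use Zq R eps_pos in \<open>auto simp: q_def\<close>)
    also have "\<dots> = 2 / (d * \<epsilon> * ?R\<^sup>2) * weight c P"
      unfolding weight_def q_def sum_distrib_left sum_divide_distrib
      by (intro sum.cong) (simp_all add: power2_eq_square mult_ac)
    finally show ?thesis .
  qed
  have "expect S (\<lambda>T. of_bool (c \<notin> T) * g T) \<le> (\<integral>s. (\<Sum>P\<in>Pow C. G P * indicator (?E P) s) \<partial>M)"
    unfolding expect_def
  proof (rule integral_mono_AE)
    show "integrable M (\<lambda>s. of_bool (c \<notin> descend S s) * g (descend S s))"
      by (rule integrable_descend[OF S])
    show "integrable M (\<lambda>s. \<Sum>P\<in>Pow C. G P * indicator (?E P) s)"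
      using E by (intro Bochner_Integration.integrable_sum integrable_mult_right) (auto simp: M.emeasure_eq_measure)
    show "AE s in M. of_bool (c \<notin> descend S s) * g (descend S s) \<le> (\<Sum>P\<in>Pow C. G P * indicator (?E P) s)"
      using AE_sample
    proof eventually_elim
      case (elim s)
      obtain i \<theta> b where s: "s = (i, \<theta>, b)" by (cases s) auto
      show ?case
      proof (cases "c \<in> descend S s")
        case True
        then show ?thesis using G by (auto intro!: sum_nonneg)
      next
        case False
        define z where "z = sign_of b * sqrt \<theta>"
        define P where "P = side c i (y i z)"
        have lost: "c \<notin> descend S (i, \<theta>, b)" "0 < \<theta>" using False elim s by auto
        note * = lost_group[OF S c lost R, folded z_def \<eta>_def, folded y_def]
        have "P \<in> Pow C" by (auto simp: P_def side_def)
        have "z \<in> Z P i" using * by (simp add: Z_def portion_def P_def q_def)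
        then have "s \<in> ?E P" by (simp add: s z_def)
        have "descend S s = S \<inter> P" using * by (simp add: s P_def)
        moreover have "descend S s \<noteq> {}" using S by (intro descend_nonempty) auto
        ultimately have "of_bool (c \<notin> descend S s) * g (descend S s) = G P * indicator (?E P) s"
          using False \<open>s \<in> ?E P\<close> by (simp add: G_def)
        also have "\<dots> \<le> (\<Sum>P\<in>Pow C. G P * indicator (?E P) s)"
          using \<open>P \<in> Pow C\<close> finite_C G by (intro member_le_sum) auto
        finally show ?thesis .
      qed
    qed
  qed
  also have "\<dots> = (\<Sum>P\<in>Pow C. G P * measure M (?E P))"
    using E by (subst Bochner_Integration.integral_sum) (auto simp: M.emeasure_eq_measure)
  also have "\<dots> \<le> (\<Sum>P\<in>Pow C. G P * (2 / (d * \<epsilon> * ?R\<^sup>2) * weight c P))"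
    using prob G by (intro sum_mono mult_left_mono) auto
  also have "\<dots> = 2 / (d * \<epsilon> * ?R\<^sup>2) * (\<Sum>P\<in>Pow C. weight c P * G P)"
    by (simp add: sum_distrib_left sum_divide_distrib mult_ac)
  finally show ?thesis by (simp add: G_def)
qed

end

section \<open>Superharmonic potentials\<close>

lemma sum_scales_le:
  fixes w W :: real
  assumes "0 < w" "0 \<le> W"
  shows "(\<Sum>j<N. if 4 ^ j * w \<le> W then 4 ^ j * w else 0) \<le> 2 * W"
proof (induction N)
  case (Suc N)
  show ?case
  proof (cases "4 ^ N * w \<le> W")
    case True
    have "(\<Sum>j<N. if 4 ^ j * w \<le> W then 4 ^ j * w else 0) \<le> (\<Sum>j<N. 4 ^ j * w)"
      using \<open>0 < w\<close> by (intro sum_mono) auto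
    \<comment> \<open>All smaller scales together weigh no more than the current one, so the total
      is at most twice the largest admissible scale.\<close>
    also have "\<dots> \<le> 4 ^ N * w"
    proof (induction N)
      case (Suc N)
      have "0 \<le> 4 ^ N * w" using \<open>0 < w\<close> by simp
      moreover have "4 ^ Suc N * w = 4 * (4 ^ N * w)" by simp
      ultimately show ?case using Suc unfolding sum.lessThan_Suc by linarith
    qed (use \<open>0 < w\<close> in simp)
    finally show ?thesis using True by simp
  qed (use Suc in simp)
qed (use assms in simp)

lemma scale_exists:
  fixes w W :: real
  assumes "w \<le> W" "W < 4 ^ N * w"
  obtains j where "j < N" "4 ^ j * w \<le> W" "W < 4 * (4 ^ j * w)"
  using assms(2)
proof (induction N arbitrary: thesis)
  case 0
  then show ?case using assms by simp
next
  case (Suc N)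
  show ?case
  proof (cases "W < 4 ^ N * w")
    case True
    then show ?thesis using Suc.IH[OF _ True] Suc.prems(1) less_SucI by blast
  next
    case False
    then show ?thesis using Suc.prems(1)[of N] Suc.prems(2) by simp
  qed
qed

lemma scale_bound_exists:
  fixes w W :: real
  assumes "0 < w" obtains N where "W < 4 ^ N * w"
  using real_arch_pow[of 4 "W / w"] assms by (auto simp: field_simps)

text \<open>Weight of scale \<open>w\<close> when the fallback center has distance \<open>r\<close>.  The square root beats the linear loss
  rate: it leaves room for the increase of \<open>damp\<close> on all scales when the fallback center itself is lost.\<close>

definition damp :: "real \<Rightarrow> real \<Rightarrow> real \<Rightarrow> real" where
  "damp L w r = (if r < 4 * w then min 1 (sqrt (L * r / w)) else 0)"

lemma damp_nonneg: "0 \<le> L \<Longrightarrow> 0 \<le> r \<Longrightarrow> 0 < w \<Longrightarrow> 0 \<le> damp L w r"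
  by (simp add: damp_def)

lemma damp_le_1: "damp L w r \<le> 1"
  by (simp add: damp_def)

text \<open>The terms vanish up to scale \<open>r / 4\<close>, are at most 1 up to
  \<open>L * r\<close>, and decay geometrically with ratio 1/2 above. Only the logarithm of the
  ratio of the two limits counts, which later gives the factor \<open>log log k\<close>.\<close>

lemma sum_damp_le:
  assumes "0 < r" "1 \<le> L" "0 < w"
  shows "(\<Sum>l<N. damp L (4 ^ l * w) r) \<le> ln (16 * L) + 2"
proof -
  define s where "s l = sqrt (L * r / (4 ^ l * w))" for l :: nat
  \<comment> \<open>Telescoping majorant: the clamped logarithm grows by \<open>ln 4 \<ge> 1\<close>
    on the middle scales, and \<open>- 2 * min 1 (s l)\<close> grows by exactly \<open>s l\<close>
    on the tail. The upper clamp is \<open>4 * L * r\<close>, so that the successor of a scale up to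
    \<open>L * r\<close> is not cut off.\<close>
  define F where "F l = max (ln (r / 4)) (min (ln (4 ^ l * w)) (ln (4 * L * r))) - 2 * min 1 (s l)" for l :: nat
  have s: "s (Suc l) = s l / 2" "0 \<le> s l" for l
    using assms by (auto simp: s_def real_sqrt_divide real_sqrt_mult)
  have ln_Suc: "ln (4 ^ Suc l * w) = ln 4 + ln (4 ^ l * w)" for l
    using assms by (simp add: ln_mult)
  have ln4: "1 \<le> ln (4::real)"
    using e_less_272 by (subst ln_ge_iff) auto
  have step: "damp L (4 ^ l * w) r \<le> F (Suc l) - F l" for l
  proof (cases "r / 4 < 4 ^ l * w \<and> 4 ^ l * w \<le> L * r")
    case True
    have "ln (r / 4) \<le> ln (4 ^ l * w)" "ln (4 ^ Suc l * w) \<le> ln (4 * L * r)"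
      using True assms by (auto intro!: ln_mono)
    then have "F (Suc l) - F l = ln 4 + 2 * min 1 (s l) - 2 * min 1 (s (Suc l))"
      unfolding F_def using ln_Suc[of l] ln4 by (simp add: max_def min_def)
    also have "\<dots> \<ge> ln 4" using s[of l] by (simp add: min_def)
    finally show ?thesis using ln4 damp_le_1[of L "4 ^ l * w" r] by linarith
  next
    case False
    have mono: "max (ln (r / 4)) (min (ln (4 ^ l * w)) (ln (4 * L * r)))
      \<le> max (ln (r / 4)) (min (ln (4 ^ Suc l * w)) (ln (4 * L * r)))"
      using ln_Suc[of l] ln4 by (intro max.mono min.mono) auto
    show ?thesis
    proof (cases "r / 4 < 4 ^ l * w")
      case True
      then have "L * r / (4 ^ l * w) \<le> 1" using False assms by (simp add: field_simps)
      then have "s l \<le> 1" by (simp add: s_def)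
      moreover have "damp L (4 ^ l * w) r = s l"
        using True \<open>s l \<le> 1\<close> by (simp add: damp_def s_def)
      ultimately show ?thesis unfolding F_def using mono s[of l] by simp
    next
      case False
      then show ?thesis unfolding F_def damp_def using mono s[of l] by (auto simp: min_def)
    qed
  qed
  have "(\<Sum>l<N. damp L (4 ^ l * w) r) \<le> (\<Sum>l<N. F (Suc l) - F l)"
    by (intro sum_mono step)
  also have "\<dots> = F N - F 0" by (rule sum_lessThan_telescope)
  finally have sum: "(\<Sum>l<N. damp L (4 ^ l * w) r) \<le> F N - F 0" .
  have "r / 4 \<le> 4 * L * r" using assms by simp
  then have "ln (r / 4) \<le> ln (4 * L * r)"
    using assms by (intro ln_mono) auto
  then have "F N \<le> ln (4 * L * r)" unfolding F_def using s(2)[of N] by (simp add: min_def max_def)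
  moreover have "F 0 \<ge> ln (r / 4) - 2" unfolding F_def by (simp add: max_def min_def)
  moreover have "ln (16 * L) = ln (4 * L * r) - ln (r / 4)"
  proof -
    have "ln (16 * L) = ln ((4 * L * r) / (r / 4))" using assms by (simp add: field_simps)
    also have "\<dots> = ln (4 * L * r) - ln (r / 4)" using assms by (subst ln_div) auto
    finally show ?thesis .
  qed
  ultimately show ?thesis using sum by linarith
qed

text \<open>Each counted scale contributes at most \<open>sqrt (4 ^ l * w / u)\<close>, and these
  roots form a geometric series of ratio 2 dominated by its top term. The square root matches the
  one in \<open>damp\<close>.\<close>

lemma count_scales_le:
  assumes "0 < w" "0 < u" "W < 4 * (4 ^ j * w)"
  shows "(\<Sum>l<N. if u < 4 ^ l * w \<and> 4 ^ l * w \<le> W then 1 else 0) \<le> 2 * sqrt (4 ^ j * w / u)"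
proof -
  have j: "l \<le> j" if "4 ^ l * w \<le> W" for l
  proof (rule ccontr)
    assume "\<not> l \<le> j"
    then have "(4::real) ^ Suc j \<le> 4 ^ l" by (intro power_increasing) auto
    then have "4 ^ Suc j * w \<le> 4 ^ l * w" using assms by (intro mult_right_mono) auto
    moreover have "4 ^ Suc j * w = 4 * (4 ^ j * w)" by simp
    ultimately show False using that assms by linarith
  qed
  have sqrt4: "sqrt (4 ^ l * w / u) = 2 ^ l * sqrt (w / u)" for l
  proof -
    have "sqrt ((4::real) ^ l) = 2 ^ l" by (simp add: real_sqrt_power)
    then show ?thesis by (simp add: real_sqrt_mult real_sqrt_divide)
  qed
  have "(\<Sum>l<N. if u < 4 ^ l * w \<and> 4 ^ l * w \<le> W then 1 else 0) \<le> (\<Sum>l<N. if l \<le> j then sqrt (4 ^ l * w / u) else 0)"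
    using assms j by (intro sum_mono) (auto simp: field_simps)
  also have "\<dots> = (\<Sum>l\<in>{..<N} \<inter> {..j}. sqrt (4 ^ l * w / u))"
    by (simp add: sum.inter_restrict)
  also have "\<dots> \<le> (\<Sum>l\<le>j. sqrt (4 ^ l * w / u))"
    using assms by (intro sum_mono2) auto
  also have "\<dots> = (\<Sum>l\<le>j. 2 ^ l) * sqrt (w / u)"
    by (simp add: sqrt4 sum_distrib_right)
  also have "(\<Sum>l\<le>j. 2 ^ l :: real) \<le> 2 * 2 ^ j"
    by (induction j) auto
  finally show ?thesis using assms by (simp add: sqrt4 mult_right_mono)
qed

section \<open>The clock of a scale\<close>

context threshold_tree
begin

abbreviation "logk \<equiv> ln (real (card C))"

lemma logk_ge_1: "1 \<le> logk"
  using e_less_272 card_C by (subst ln_ge_iff) auto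

definition far :: "real \<Rightarrow> pt set \<Rightarrow> pt set" where
  "far w S = {e \<in> S. w \<le> dist_d d x e}"

text \<open>Up to a factor of order \<open>d\<close>, the expected number of further rounds that a center at distance at
  least \<open>w\<close> survives next to \<open>x\<close> and \<open>c\<close>.\<close>

definition clock :: "pt \<Rightarrow> real \<Rightarrow> pt set \<Rightarrow> real" where
  "clock c w S = (if c \<in> S \<and> far w S \<noteq> {} then 1 + ln (real (card (far w S) * card S)) else 0)"

lemma far_mono: "T \<subseteq> S \<Longrightarrow> far w T \<subseteq> far w S"
  by (auto simp: far_def)

lemma finite_far: "S \<in> groups \<Longrightarrow> finite (far w S)"
  using finite_group[of S] by (auto simp: far_def)

lemma clock_nonneg: "0 \<le> clock c w S"
proof (cases "card (far w S) * card S = 0")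
  case False
  then have "0 \<le> ln (real (card (far w S) * card S))" by (intro ln_ge_zero) linarith
  then show ?thesis by (simp add: clock_def)
qed (auto simp: clock_def)

lemma card_far_pos:
  assumes "S \<in> groups" "T \<subseteq> S" "far w T \<noteq> {}"
  shows "1 \<le> card (far w T) * card T"
proof -
  have "T \<noteq> {}" using assms by (auto simp: far_def)
  moreover have "finite T" using finite_group[OF assms(1)] assms(2) finite_subset by blast
  moreover from this have "finite (far w T)" by (simp add: far_def)
  ultimately have "0 < card (far w T)" "0 < card T" using assms by (simp_all add: card_gt_0_iff)
  then show ?thesis by (metis Suc_leI One_nat_def nat_0_less_mult_iff)
qed

lemma clock_mono:
  assumes S: "S \<in> groups" and T: "T \<subseteq> S"
  shows "clock c w T \<le> clock c w S"
proof -
  note pos = card_far_pos[OF S]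
  show ?thesis
  proof (cases "c \<in> T \<and> far w T \<noteq> {}")
    case True
    have "card (far w T) * card T \<le> card (far w S) * card S"
      using far_mono[OF T] T finite_far[OF S] finite_group[OF S] by (intro mult_le_mono card_mono)
    then have "ln (real (card (far w T) * card T)) \<le> ln (real (card (far w S) * card S))"
      using pos[OF T, of w] True by (intro ln_mono) (auto simp del: of_nat_mult)
    then show ?thesis using True T far_mono[OF T, of w] by (auto simp: clock_def)
  next
    case False
    have "0 \<le> ln (real (card (far w S) * card S))" if "far w S \<noteq> {}"
      using pos[OF subset_refl that] by (intro ln_ge_zero) linarith
    then show ?thesis using False by (auto simp: clock_def)
  qed
qed

lemma clock_le:
  assumes S: "S \<in> groups"
  shows "clock c w S \<le> 3 * logk"
proof (cases "far w S \<noteq> {}")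
  case True
  have "card (far w S) \<le> card C" "card S \<le> card C"
    using S finite_C by (auto intro!: card_mono simp: far_def)
  then have le: "card (far w S) * card S \<le> card C * card C" by (intro mult_le_mono)
  have "card (far w S) > 0" "card S > 0"
    using True S finite_far[OF S] finite_group[OF S] by (auto simp: card_gt_0_iff)
  then have "ln (real (card (far w S) * card S)) \<le> ln (real (card C * card C))"
    using le by (intro ln_mono) (auto simp del: of_nat_mult)
  also have "\<dots> = 2 * logk" using card_C by (simp add: ln_mult)
  finally show ?thesis using logk_ge_1 by (simp add: clock_def)
next
  case False
  then show ?thesis using logk_ge_1 by (simp add: clock_def)
qed

lemma clock_eq_0:
  assumes "S \<in> groups" "reach S < w"
  shows "clock c w S = 0"
proof -
  have "\<not> w \<le> dist_d d x e" if "e \<in> S" for e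
    using dist_le_reach[OF assms(1) that] assms(2) by linarith
  then show ?thesis by (simp add: clock_def far_def)
qed

text \<open>If both \<open>c\<close> and \<open>e\<close> were within \<open>reach S / 16\<close> of
  the median, then \<open>e\<close> would be closer to \<open>x\<close> than
  \<open>w/8 + w/2 < w\<close>. So one of them is far from the median and
  \<open>expect_progress_ge\<close> applies to it; 9216 = 4 * 9 * 256.\<close>

lemma far_progress:
  assumes S: "S \<in> groups" and c: "c \<in> S" and w: "0 < w" "8 * dist_d d x c \<le> w"
    and scale: "w \<le> reach S" "reach S < 4 * w" and e: "e \<in> far w S"
  shows "1 / (9216 * d) \<le> expect S (\<lambda>T. of_bool (c \<notin> T \<or> e \<notin> T \<or> 2 * card T \<le> card S))"
proof -
  let ?m = "med S"
  have eS: "e \<in> S" "w \<le> dist_d d x e" using e by (auto simp: far_def)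
  have "e \<noteq> c" using eS w dist_d_nonneg[of d x c] by auto
  then have card: "card S \<ge> 2"
    using c eS finite_group[OF S] card_mono[of S "{c, e}"] by simp
  have R: "radius S > 0" by (rule radius_pos[OF S card])
  have "\<exists>f\<in>{c, e}. reach S / 16 \<le> dist_d d f ?m"
  proof (rule ccontr)
    assume *: "\<not> ?thesis"
    have "dist_d d x e \<le> dist_d d x c + dist_d d c ?m + dist_d d ?m e"
      using dist_d_triangle[of d x e c] dist_d_triangle[of d c e ?m] by linarith
    then show False using * eS w scale by (simp add: dist_d_commute[of d ?m e])
  qed
  then obtain f where f: "f \<in> {c, e}" "reach S / 16 \<le> dist_d d f ?m" by blast
  have "1 / (9216 * d) = (reach S / 16)\<^sup>2 / (4 * d * (3 * reach S)\<^sup>2)"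
    using w scale by (simp add: power_divide power_mult_distrib)
  also have "\<dots> \<le> (dist_d d f ?m)\<^sup>2 / (4 * d * (radius S)\<^sup>2)"
  proof (rule frac_le)
    show "(reach S / 16)\<^sup>2 \<le> (dist_d d f ?m)\<^sup>2" using f reach_nonneg[OF S] by (intro power_mono) auto
    show "4 * d * (radius S)\<^sup>2 \<le> 4 * d * (3 * reach S)\<^sup>2"
      using R radius_le_reach[OF S] by (intro mult_left_mono power_mono) auto
  qed (use d R in auto)
  also have "\<dots> \<le> expect S (\<lambda>T. of_bool (f \<notin> T \<or> 2 * card T \<le> card S))"
    using f c eS by (intro expect_progress_ge[OF S card]) auto
  also have "\<dots> \<le> expect S (\<lambda>T. of_bool (c \<notin> T \<or> e \<notin> T \<or> 2 * card T \<le> card S))"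
    using f by (intro expect_mono[OF S]) auto
  finally show ?thesis .
qed

text \<open>In the product \<open>card (far w S) * card S\<close>, each far center contributes
  \<open>card S\<close>, and this contribution is at least halved with probability at least
  \<open>\<beta>\<close>. Hence the product shrinks by the factor \<open>1 - \<beta> / 2\<close> in
  expectation, and concavity of \<open>ln\<close> turns this into an additive decrease.\<close>

lemma expect_clock_less:
  assumes S: "S \<in> groups" and c: "c \<in> S" and w: "0 < w" "8 * dist_d d x c \<le> w"
    and scale: "w \<le> reach S" "reach S < 4 * w"
  shows "expect S (clock c w) \<le> clock c w S - 1 / (20000 * d)"
proof -
  let ?n = "real (card S)"
  define Y where "Y = real (card (far w S)) * ?n"
  define \<beta> where "\<beta> = 1 / (9216 * real d)"
  have ne: "far w S \<noteq> {}"
    using reach_attained[OF S] scale by (auto simp: far_def)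
  have Y: "Y \<ge> 1"
  proof -
    have "card (far w S) \<ge> 1" "card S \<ge> 1"
      using ne S finite_far[OF S] finite_group[OF S] by (auto simp: Suc_le_eq card_gt_0_iff)
    then show ?thesis unfolding Y_def by (intro mult_ge1_I) auto
  qed
  have clockS: "clock c w S = 1 + ln Y" using c ne by (simp add: clock_def Y_def)
  \<comment> \<open>Tangent bound for \<open>ln\<close> at \<open>Y\<close>. The summand 1 in
    \<open>clock\<close> cancels the \<open>- 1\<close> of the tangent, so the right-hand side is
    nonnegative and also covers outcomes where the clock drops to 0.\<close>
  have pt: "clock c w T \<le> ln Y + 1 / Y * (\<Sum>e\<in>far w S. ?n * (1 - of_bool (c \<notin> T \<or> e \<notin> T \<or> 2 * card T \<le> card S) / 2))"
    (is "_ \<le> _ + 1 / Y * ?B T") if T: "T \<subseteq> S" "T \<noteq> {}" for T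
  proof (cases "c \<in> T \<and> far w T \<noteq> {}")
    case True
    let ?Y = "real (card (far w T) * card T)"
    have pos: "0 < ?Y"
      using card_far_pos[OF S T(1), of w] True by linarith
    have cT: "card T \<le> card S" using T finite_group[OF S] by (intro card_mono)
    have "?Y = (\<Sum>e\<in>far w T. real (card T))" by simp
    also have "\<dots> = (\<Sum>e\<in>far w S. if e \<in> T then real (card T) else 0)"
    proof -
      have "far w T = {e \<in> far w S. e \<in> T}" using T(1) by (auto simp: far_def)
      then show ?thesis using sum.inter_filter[OF finite_far[OF S, of w], of "\<lambda>_. real (card T)" "\<lambda>e. e \<in> T"] by simp
    qed
    also have "\<dots> \<le> ?B T"
      using cT True by (intro sum_mono) (auto simp: field_simps)
    finally have B: "?Y \<le> ?B T" .
    have "ln ?Y - ln Y = ln (?Y / Y)" using pos Y by (subst ln_div) (simp_all del: of_nat_mult)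
    also have "\<dots> \<le> ?Y / Y - 1" using pos Y by (intro ln_le_minus_one divide_pos_pos) (simp_all del: of_nat_mult)
    also have "?Y / Y \<le> ?B T / Y" using B Y by (intro divide_right_mono) auto
    finally show ?thesis using True by (simp add: clock_def)
  next
    case False
    have "0 \<le> ?B T" by (intro sum_nonneg) auto
    then show ?thesis using False Y by (auto simp: clock_def intro!: add_nonneg_nonneg)
  qed
  have "expect S (clock c w) \<le> expect S (\<lambda>T. ln Y + 1 / Y *
     (\<Sum>e\<in>far w S. ?n + (- ?n / 2) * of_bool (c \<notin> T \<or> e \<notin> T \<or> 2 * card T \<le> card S)))"
    using pt by (intro expect_mono[OF S]) (simp add: algebra_simps)
  also have "\<dots> = ln Y + 1 / Y * (\<Sum>e\<in>far w S. ?n + (- ?n / 2) *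
     expect S (\<lambda>T. of_bool (c \<notin> T \<or> e \<notin> T \<or> 2 * card T \<le> card S)))"
    by (simp only: expect_add[OF S] expect_cmult[OF S] expect_sum[OF S] expect_const[OF S])
  also have "\<dots> \<le> ln Y + 1 / Y * (\<Sum>e\<in>far w S. ?n + (- ?n / 2) * \<beta>)"
    using far_progress[OF S c w scale] Y unfolding \<beta>_def
    by (intro add_left_mono mult_left_mono sum_mono mult_left_mono_neg) auto
  also have "\<dots> = ln Y + (1 - \<beta> / 2)"
  proof -
    have "(\<Sum>e\<in>far w S. ?n + (- ?n / 2) * \<beta>) = Y * (1 - \<beta> / 2)" by (simp add: Y_def algebra_simps)
    then show ?thesis using Y by simp
  qed
  also have "\<dots> \<le> clock c w S - 1 / (20000 * d)"
    using d by (simp add: clockS \<beta>_def field_simps)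
  finally show ?thesis .
qed

lemma expect_clock_le: "S \<in> groups \<Longrightarrow> expect S (clock c w) \<le> clock c w S"
  using clock_mono by (intro expect_le_const)

section \<open>Superharmonic functions and the least of them\<close>

definition superharmonic :: "(pt set \<Rightarrow> real) \<Rightarrow> bool" where
  "superharmonic \<Phi> \<longleftrightarrow> (\<forall>S\<in>groups. 0 \<le> \<Phi> S \<and> expect S \<Phi> \<le> \<Phi> S) \<and> (\<forall>c\<in>C. (dist_d d x c)\<^sup>2 \<le> \<Phi> {c})"

text \<open>An infimum of superharmonic functions is superharmonic, so \<open>value_of\<close> can be bounded on different
  states by different potentials and still be used as the terminal cost of another one.\<close>

definition value_of :: "pt set \<Rightarrow> real" where
  "value_of S = (INF \<Phi>\<in>Collect superharmonic. \<Phi> S)"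

text \<open>\<open>reach\<close> never increases along the chain. This gives the crude bound on the
  cost after a loss, and shows that the infimum in \<open>value_of\<close> is over a nonempty
  set.\<close>

lemma superharmonic_reach: "superharmonic (\<lambda>S. (reach S)\<^sup>2)"
  unfolding superharmonic_def
  by (auto intro!: expect_le_const power_mono reach_mono reach_nonneg simp: reach_def[of "{_}"])

lemma value_of_le: "S \<in> groups \<Longrightarrow> superharmonic \<Phi> \<Longrightarrow> value_of S \<le> \<Phi> S"
  unfolding value_of_def by (rule cINF_lower) (auto simp: superharmonic_def intro!: bdd_belowI[of _ 0])

lemma superharmonic_value_of: "superharmonic value_of"
proof -
  have ne: "Collect superharmonic \<noteq> {}" using superharmonic_reach by blast
  have "0 \<le> value_of S \<and> expect S value_of \<le> value_of S" if S: "S \<in> groups" for S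
  proof
    show "0 \<le> value_of S"
      unfolding value_of_def using S by (intro cINF_greatest[OF ne]) (auto simp: superharmonic_def)
    have "expect S value_of \<le> \<Phi> S" if \<Phi>: "superharmonic \<Phi>" for \<Phi>
    proof -
      have "expect S value_of \<le> expect S \<Phi>"
        using S by (intro expect_mono[OF S] value_of_le[OF _ \<Phi>]) auto
      also have "\<dots> \<le> \<Phi> S"
        using \<Phi> S unfolding superharmonic_def by blast
      finally show ?thesis .
    qed
    then show "expect S value_of \<le> value_of S"
      unfolding value_of_def[of S] by (intro cINF_greatest[OF ne]) auto
  qed
  moreover have "(dist_d d x c)\<^sup>2 \<le> value_of {c}" if "c \<in> C" for c
    unfolding value_of_def using that by (intro cINF_greatest[OF ne]) (auto simp: superharmonic_def)
  ultimately show ?thesis by (simp add: superharmonic_def)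
qed


section \<open>First potential: a bound linear in distance and reach\<close>

abbreviation scale :: "real \<Rightarrow> nat \<Rightarrow> real" where
  "scale w j \<equiv> 4 ^ j * w"

lemma value_of_nonneg: "S \<in> groups \<Longrightarrow> 0 \<le> value_of S"
  using superharmonic_value_of by (simp add: superharmonic_def)

lemma value_of_le_reach: "S \<in> groups \<Longrightarrow> value_of S \<le> (reach S)\<^sup>2"
  by (rule value_of_le[OF _ superharmonic_reach])

text \<open>Let \<open>D\<close> be the distance of \<open>c\<close>. While
  \<open>reach S \<ge> w\<close>, the clock of the current scale \<open>j\<close> pays for the loss
  of \<open>c\<close>: its term falls by \<open>80 * D * scale w j / d\<close> in expectation, with
  80 = 1600000 / 20000, and the loss costs at most \<open>20 * D * reach S / d\<close>, which is no
  more since \<open>reach S < 4 * scale w j\<close>. When \<open>reach S < w\<close>, the term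
  \<open>w\<^sup>2\<close> covers a loss; without \<open>c\<close> the potential is the squared
  reach.\<close>

lemma superharmonic_scales:
  assumes c: "c \<in> C" and w: "0 < w" "8 * dist_d d x c \<le> w" and N: "reach C < scale w N"
  defines "\<Phi> \<equiv> \<lambda>S. if c \<in> S then w\<^sup>2 + 1600000 * dist_d d x c * (\<Sum>j<N. scale w j * clock c (scale w j) S) else (reach S)\<^sup>2"
  shows "superharmonic \<Phi>"
  unfolding superharmonic_def
proof (intro conjI ballI)
  let ?D = "dist_d d x c"
  have sc: "0 < scale w j" "w \<le> scale w j" for j
    using w by (auto intro: order_trans[of w "1 * w"] mult_right_mono)
  have nn: "0 \<le> (\<Sum>j<N. scale w j * clock c (scale w j) S)" for S
    using w by (intro sum_nonneg mult_nonneg_nonneg clock_nonneg) auto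
  fix S assume S: "S \<in> groups"
  show "0 \<le> \<Phi> S"
    using nn[of S] w unfolding \<Phi>_def by (auto intro!: add_nonneg_nonneg mult_nonneg_nonneg)
  show "expect S \<Phi> \<le> \<Phi> S"
  proof (cases "c \<in> S \<and> w \<le> reach S")
    case True
    have W: "0 < reach S" "8 * ?D \<le> reach S" using True w by auto
    have "reach S \<le> reach C" using S by (intro reach_mono) auto
    then obtain j where j: "j < N" "scale w j \<le> reach S" "reach S < 4 * scale w j"
      using scale_exists[of w "reach S" N] N True by auto
    let ?X = "\<lambda>T. \<Sum>j<N. scale w j * clock c (scale w j) T"
    have "expect S \<Phi> \<le> expect S (\<lambda>T. (w\<^sup>2 + 1600000 * ?D * ?X T) + (reach S)\<^sup>2 * of_bool (c \<notin> T))"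
    proof (rule expect_mono[OF S])
      fix T assume T: "T \<subseteq> S" "T \<noteq> {}"
      then have "T \<in> groups" using S by auto
      show "\<Phi> T \<le> (w\<^sup>2 + 1600000 * ?D * ?X T) + (reach S)\<^sup>2 * of_bool (c \<notin> T)"
        using nn[of T] reach_mono[OF S T] reach_nonneg[OF \<open>T \<in> groups\<close>]
        by (auto simp: \<Phi>_def intro!: power_mono add_increasing mult_nonneg_nonneg)
    qed
    also have "\<dots> = (w\<^sup>2 + 1600000 * ?D * (\<Sum>j<N. scale w j * expect S (clock c (scale w j))))
        + (reach S)\<^sup>2 * expect S (\<lambda>T. of_bool (c \<notin> T))"
      by (simp only: expect_add[OF S] expect_cmult[OF S] expect_sum[OF S] expect_const[OF S])
    also have "\<dots> \<le> (w\<^sup>2 + 1600000 * ?D * (?X S - scale w j / (20000 * d))) + (reach S)\<^sup>2 * (20 * ?D / (d * reach S))"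
    proof (intro add_mono mult_left_mono order_refl)
      have "(\<Sum>l<N. scale w l * expect S (clock c (scale w l)))
        \<le> (\<Sum>l<N. scale w l * (clock c (scale w l) S - (if l = j then 1 / (20000 * d) else 0)))"
        using sc True j w expect_clock_less[OF S, of c "scale w j"] expect_clock_le[OF S] sc(2)[of j]
        by (intro sum_mono mult_left_mono) (auto simp: less_imp_le)
      also have "\<dots> = ?X S - (\<Sum>l<N. if l = j then scale w l / (20000 * d) else 0)"
        unfolding sum_subtractf[symmetric] by (intro sum.cong) (auto simp: algebra_simps)
      also have "\<dots> = ?X S - scale w j / (20000 * d)"
        using j by simp
      finally show "(\<Sum>l<N. scale w l * expect S (clock c (scale w l))) \<le> ?X S - scale w j / (20000 * d)" .
      show "expect S (\<lambda>T. of_bool (c \<notin> T)) \<le> 20 * ?D / (d * reach S)"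
        using True W by (intro expect_lose_le[OF S] reach_le_radius[OF S]) auto
    qed auto
    also have "\<dots> = \<Phi> S - ?D / d * (80 * scale w j - 20 * reach S)"
      using True W d by (simp add: \<Phi>_def field_simps power2_eq_square)
    also have "\<dots> \<le> \<Phi> S"
    proof -
      have "0 \<le> ?D / d * (80 * scale w j - 20 * reach S)"
        by (intro mult_nonneg_nonneg) (simp, use j in linarith)
      then show ?thesis by linarith
    qed
    finally show ?thesis .
  next
    case False
    show ?thesis
    proof (rule expect_le_const[OF S])
      fix T assume T: "T \<subseteq> S" "T \<noteq> {}"
      then have "T \<in> groups" using S by auto
      have R: "(reach T)\<^sup>2 \<le> (reach S)\<^sup>2"
        using reach_mono[OF S T] reach_nonneg[OF \<open>T \<in> groups\<close>] by (intro power_mono)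
      show "\<Phi> T \<le> \<Phi> S"
      proof (cases "c \<in> S")
        case True
        then have W: "(reach S)\<^sup>2 \<le> w\<^sup>2" using False reach_nonneg[OF S] by (intro power_mono) auto
        have "(\<Sum>j<N. scale w j * clock c (scale w j) T) \<le> (\<Sum>j<N. scale w j * clock c (scale w j) S)"
          using sc clock_mono[OF S T(1)] by (intro sum_mono mult_left_mono) (auto simp: less_imp_le)
        then have "1600000 * ?D * (\<Sum>j<N. scale w j * clock c (scale w j) T) \<le> 1600000 * ?D * (\<Sum>j<N. scale w j * clock c (scale w j) S)"
          by (intro mult_left_mono) auto
        moreover have "0 \<le> 1600000 * ?D * (\<Sum>j<N. scale w j * clock c (scale w j) S)"
          using nn[of S] by (intro mult_nonneg_nonneg) auto
        ultimately show ?thesis using True R W unfolding \<Phi>_def by auto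
      next
        case False
        then show ?thesis using T R by (auto simp: \<Phi>_def)
      qed
    qed
  qed
next
  let ?D = "dist_d d x c"
  fix e assume "e \<in> C"
  then have "{e} \<in> groups" by auto
  show "(dist_d d x e)\<^sup>2 \<le> \<Phi> {e}"
  proof (cases "e = c")
    case True
    have "?D \<le> w" using w dist_d_nonneg[of d x c] by linarith
    then have "?D\<^sup>2 \<le> w\<^sup>2" by (intro power_mono) auto
    moreover have "0 \<le> 1600000 * ?D * (\<Sum>j<N. scale w j * clock c (scale w j) {c})"
      using w by (intro mult_nonneg_nonneg sum_nonneg clock_nonneg) auto
    ultimately show ?thesis using True by (simp add: \<Phi>_def)
  next
    case False
    then show ?thesis by (simp add: \<Phi>_def reach_def)
  qed
qed

text \<open>A bound that does not depend on \<open>\<epsilon>\<close>; only in terms of it can the main potential afford a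
  number of scales of order \<open>log log k\<close>.\<close>

lemma value_of_le_dist_reach:
  assumes S: "S \<in> groups" and c: "c \<in> S"
  shows "value_of S \<le> 10000000 * logk * dist_d d x c * reach S"
proof -
  let ?D = "dist_d d x c"
  have cC: "c \<in> C" using S c by auto
  have bound: "value_of S \<le> w\<^sup>2 + 9600000 * logk * ?D * reach S" if w: "0 < w" "8 * ?D \<le> w" for w
  proof -
    obtain N where N: "reach C < scale w N" using scale_bound_exists[OF w(1)] .
    have "value_of S \<le> w\<^sup>2 + 1600000 * ?D * (\<Sum>j<N. scale w j * clock c (scale w j) S)"
      using value_of_le[OF S superharmonic_scales[OF cC w N]] c by simp
    also have "\<dots> \<le> w\<^sup>2 + 1600000 * ?D * (\<Sum>j<N. 3 * logk * (if scale w j \<le> reach S then scale w j else 0))"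
      using clock_le[OF S, of c] clock_eq_0[OF S] w
      by (intro add_left_mono mult_left_mono sum_mono) (auto simp: mult.commute)
    also have "\<dots> \<le> w\<^sup>2 + 1600000 * ?D * (3 * logk * (2 * reach S))"
      unfolding sum_distrib_left[symmetric] using sum_scales_le[OF w(1) reach_nonneg[OF S], of N] logk_ge_1
      by (intro add_left_mono mult_left_mono) auto
    finally show ?thesis by (simp add: mult_ac)
  qed
  show ?thesis
  proof (cases "?D = 0")
    case True
    \<comment> \<open>The scale \<open>w\<close> must be positive, but for distance 0 it may be
      arbitrarily small: take \<open>w = sqrt e\<close> and let \<open>e\<close> tend to 0.\<close>
    have "value_of S \<le> e" if "0 < e" for e
      using bound[of "sqrt e"] that True by simp
    then have "value_of S \<le> 0" by (rule dense_ge)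
    then show ?thesis using True by simp
  next
    case False
    then have "0 < ?D" using dist_d_nonneg[of d x c] by linarith
    have "?D * ?D \<le> ?D * reach S" using dist_le_reach[OF S c] \<open>0 < ?D\<close> by (intro mult_left_mono) auto
    also have "\<dots> \<le> logk * (?D * reach S)"
      using mult_right_mono[OF logk_ge_1, of "?D * reach S"] \<open>0 < ?D\<close> reach_nonneg[OF S] by simp
    finally have "(8 * ?D)\<^sup>2 \<le> 64 * (logk * (?D * reach S))" by (simp add: power2_eq_square)
    moreover have "0 \<le> logk * (?D * reach S)" using logk_ge_1 \<open>0 < ?D\<close> reach_nonneg[OF S] by simp
    \<comment> \<open>The choice \<open>w = 8 * ?D\<close> contributes 64, which fits between
      9600000 and 10000000.\<close>
    ultimately show ?thesis using bound[of "8 * ?D"] \<open>0 < ?D\<close> by (simp add: mult.assoc)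
  qed
qed

section \<open>Second potential: damped clocks\<close>

definition fallback :: "pt set \<Rightarrow> pt set \<Rightarrow> real" where
  "fallback P S = Min (dist_d d x ` (S \<inter> P))"

text \<open>The factor in \<open>value_of_le_dist_reach\<close>: a loss that leaves a center at
  distance \<open>r\<close> costs at most \<open>Lk * r * reach S\<close>.\<close>

abbreviation "Lk \<equiv> 10000000 * logk"

text \<open>Prepayment for a loss with pattern \<open>P\<close>: each scale is charged its clock,
  damped according to how cheap the nearest survivor makes the loss. The empty case also avoids the
  unspecified minimum of an empty set.\<close>

definition scale_sum :: "pt \<Rightarrow> real \<Rightarrow> nat \<Rightarrow> pt set \<Rightarrow> pt set \<Rightarrow> real" where
  "scale_sum c w N P S = (if S \<inter> P = {} then 0 else
     \<Sum>j<N. clock c (scale w j) S * damp Lk (scale w j) (fallback P S))"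

lemma fallback_attained:
  assumes S: "S \<in> groups" and "S \<inter> P \<noteq> {}"
  shows "\<exists>e\<in>S \<inter> P. fallback P S = dist_d d x e"
proof -
  have "Min (dist_d d x ` (S \<inter> P)) \<in> dist_d d x ` (S \<inter> P)"
    using finite_group[OF S] assms(2) by (intro Min_in) auto
  then show ?thesis unfolding fallback_def by (rule imageE) blast
qed

lemma fallback_nonneg: "S \<in> groups \<Longrightarrow> S \<inter> P \<noteq> {} \<Longrightarrow> 0 \<le> fallback P S"
  using fallback_attained[of S P] by (metis dist_d_nonneg)

lemma fallback_mono:
  assumes S: "S \<in> groups" and "T \<subseteq> S" "T \<inter> P \<noteq> {}"
  shows "fallback P S \<le> fallback P T"
  unfolding fallback_def using assms finite_group[OF S] by (intro Min_antimono) auto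

text \<open>The clock of the current scale decreases, with weight \<open>B j\<close>. Against this,
  the nearest survivor \<open>e\<close> may be lost, which raises the damping factor on the scales
  in \<open>gap\<close>. That happens with probability at most
  \<open>20 * r / (d * reach S)\<close>, and the square root in \<open>damp\<close> makes the
  expected increase at most half of the decrease.\<close>

lemma expect_scale_sum_le:
  assumes S: "S \<in> groups" and c: "c \<in> S" and w: "0 < w" "8 * dist_d d x c \<le> w" "w \<le> reach S"
    and N: "reach S < scale w N" and pos: "\<And>e. e \<in> C \<Longrightarrow> 0 < dist_d d x e"
  shows "expect S (scale_sum c w N P)
    \<le> scale_sum c w N P S - (if S \<inter> P = {} then 0 else min 1 (Lk * fallback P S / reach S)) / (40000 * d)"
proof (cases "S \<inter> P = {}")
  case True
  then have "T \<inter> P = {}" if "T \<subseteq> S" for T using that by blast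
  then show ?thesis
    using True expect_mono[OF S, of "scale_sum c w N P" "\<lambda>_. 0"] S by (simp add: scale_sum_def)
next
  case False
  let ?W = "reach S"
  define r where "r = fallback P S"
  obtain e where e: "e \<in> S" "e \<in> P" "r = dist_d d x e" using fallback_attained[OF S False] by (auto simp: r_def)
  have r: "0 < r" using pos[of e] e S by auto
  have W: "0 < ?W" "8 * dist_d d x c \<le> ?W" using w by auto
  have rW: "r \<le> ?W" using e dist_le_reach[OF S] by simp
  obtain j where j: "j < N" "scale w j \<le> ?W" "?W < 4 * scale w j"
    using scale_exists[OF w(3) N] .
  have L: "1 \<le> Lk" using logk_ge_1 by simp
  have sc: "0 < scale w l" "w \<le> scale w l" for l
    using w by (auto intro: order_trans[of w "1 * w"] mult_right_mono)
  \<comment> \<open>The damping is frozen at its value for \<open>S\<close>, so that only the clocks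
    vary under the expectation.\<close>
  define B where "B l = damp Lk (scale w l) r" for l
  have B: "0 \<le> B l" "B l \<le> 1" for l using damp_nonneg[of Lk r "scale w l"] L r sc(1)[of l] by (auto simp: B_def damp_le_1)
  define gap where "gap l = (if Lk * r < scale w l \<and> scale w l \<le> ?W then 1 else 0 :: real)" for l
  have pt: "scale_sum c w N P T \<le> (\<Sum>l<N. B l * clock c (scale w l) T) + (\<Sum>l<N. 3 * logk * gap l) * of_bool (e \<notin> T)"
    if T: "T \<subseteq> S" "T \<noteq> {}" for T
  proof (cases "T \<inter> P = {}")
    case True
    have "0 \<le> (\<Sum>l<N. B l * clock c (scale w l) T) + (\<Sum>l<N. 3 * logk * gap l) * of_bool (e \<notin> T)"
      using B clock_nonneg logk_ge_1
      by (intro add_nonneg_nonneg mult_nonneg_nonneg sum_nonneg) (auto simp: gap_def)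
    then show ?thesis using True by (simp add: scale_sum_def)
  next
    case ne: False
    have TG: "T \<in> groups" using S T by auto
    have rT: "r \<le> fallback P T" using fallback_mono[OF S T(1) ne] by (simp add: r_def)
    have "clock c (scale w l) T * damp Lk (scale w l) (fallback P T)
        \<le> B l * clock c (scale w l) T + 3 * logk * gap l * of_bool (e \<notin> T)" for l
    proof (cases "e \<in> T")
      case True
      have "fallback P T \<le> r"
        unfolding fallback_def e(3) using True e finite_group[OF TG] by (intro Min_le) auto
      then have "fallback P T = r" using rT by simp
      then show ?thesis using True by (simp add: B_def)
    next
      case out: False
      have cl: "0 \<le> clock c (scale w l) T" "clock c (scale w l) T \<le> 3 * logk"
        using clock_nonneg clock_le[OF TG] by auto
      have db: "damp Lk (scale w l) (fallback P T) \<le> 1" by (rule damp_le_1)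
      \<comment> \<open>Outside \<open>gap\<close> nothing is added: on small scales the damping
        stays 0, on the next ones \<open>B l\<close> is already 1, and above \<open>reach S\<close>
        the clock is 0.\<close>
      consider "4 * scale w l \<le> r" | "r < 4 * scale w l" "scale w l \<le> Lk * r" | "gap l = 1" | "?W < scale w l"
        unfolding gap_def by argo
      then show ?thesis
      proof cases
        case 1
        then have "damp Lk (scale w l) (fallback P T) = 0" using rT by (simp add: damp_def)
        then show ?thesis using B(1)[of l] cl logk_ge_1 by (simp add: gap_def)
      next
        case 2
        then have "1 \<le> Lk * r / scale w l" using sc[of l] by (simp add: pos_le_divide_eq)
        then have "B l = 1" using 2 by (simp add: B_def damp_def)
        then have "clock c (scale w l) T * damp Lk (scale w l) (fallback P T) \<le> B l * clock c (scale w l) T"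
          using mult_left_mono[OF db cl(1)] by simp
        moreover have "0 \<le> 3 * logk * gap l * of_bool (e \<notin> T)" using logk_ge_1 by (simp add: gap_def)
        ultimately show ?thesis by linarith
      next
        case 3
        have "clock c (scale w l) T * damp Lk (scale w l) (fallback P T) \<le> 3 * logk"
          using mult_left_mono[OF db cl(1)] cl by simp
        moreover have "0 \<le> B l * clock c (scale w l) T" using B(1) cl by simp
        ultimately show ?thesis using 3 out by simp
      next
        case 4
        then have "clock c (scale w l) T = 0"
          using reach_mono[OF S T] by (intro clock_eq_0[OF TG]) auto
        then show ?thesis using logk_ge_1 by (simp add: gap_def)
      qed
    qed
    then have "(\<Sum>l<N. clock c (scale w l) T * damp Lk (scale w l) (fallback P T))
       \<le> (\<Sum>l<N. B l * clock c (scale w l) T + 3 * logk * gap l * of_bool (e \<notin> T))"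
      by (intro sum_mono)
    then show ?thesis using ne by (simp add: scale_sum_def sum.distrib sum_distrib_right)
  qed
  have Q: "scale_sum c w N P S = (\<Sum>l<N. B l * clock c (scale w l) S)"
    using False by (simp add: scale_sum_def r_def B_def mult.commute)
  have "expect S (scale_sum c w N P)
    \<le> expect S (\<lambda>T. (\<Sum>l<N. B l * clock c (scale w l) T) + (\<Sum>l<N. 3 * logk * gap l) * of_bool (e \<notin> T))"
    by (rule expect_mono[OF S pt])
  also have "\<dots> = (\<Sum>l<N. B l * expect S (clock c (scale w l))) + (\<Sum>l<N. 3 * logk * gap l) * expect S (\<lambda>T. of_bool (e \<notin> T))"
    by (simp only: expect_add[OF S] expect_cmult[OF S] expect_sum[OF S])
  also have "\<dots> \<le> (scale_sum c w N P S - B j / (20000 * d)) + (\<Sum>l<N. 3 * logk * gap l) * (20 * r / (d * ?W))"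
  proof (intro add_mono mult_left_mono)
    have "(\<Sum>l<N. B l * expect S (clock c (scale w l)))
        \<le> (\<Sum>l<N. B l * (clock c (scale w l) S - (if l = j then 1 / (20000 * d) else 0)))"
      using sc c j w B expect_clock_less[OF S, of c "scale w j"] expect_clock_le[OF S] sc(2)[of j]
      by (intro sum_mono mult_left_mono) auto
    also have "\<dots> = scale_sum c w N P S - (\<Sum>l<N. if l = j then B l / (20000 * d) else 0)"
      unfolding Q sum_subtractf[symmetric] by (intro sum.cong) (auto simp: algebra_simps)
    also have "\<dots> = scale_sum c w N P S - B j / (20000 * d)" using j by simp
    finally show "(\<Sum>l<N. B l * expect S (clock c (scale w l))) \<le> scale_sum c w N P S - B j / (20000 * d)" .
    show "expect S (\<lambda>T. of_bool (e \<notin> T)) \<le> 20 * r / (d * ?W)"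
      unfolding e(3) using e c W by (intro expect_lose_le[OF S] reach_le_radius[OF S, of c]) auto
    show "0 \<le> (\<Sum>l<N. 3 * logk * gap l)" using logk_ge_1 by (intro sum_nonneg) (auto simp: gap_def)
  qed
  also have "\<dots> \<le> scale_sum c w N P S - B j / (40000 * d)"
  proof -
    let ?n = "\<Sum>l<N. gap l"
    \<comment> \<open>Here 60 = 3 * 20 from the clock bound and the loss rate, and
      \<open>B j / 40000\<close> is half of the decrease up to the common factor
      \<open>1 / d\<close>. If \<open>scale w j \<le> Lk * r\<close>, then \<open>gap\<close> is
      empty, as the next scale exceeds \<open>reach S\<close>; otherwise the left side is of order
      \<open>logk * (v\<^sup>2 / Lk) * (1 / v)\<close> with \<open>B j = v\<close>.\<close>
    have "60 * logk * (r / ?W) * ?n \<le> B j / 40000"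
    proof (cases "scale w j \<le> Lk * r")
      case True
      have "gap l = 0" for l
      proof (rule ccontr)
        assume "gap l \<noteq> 0"
        then have l: "Lk * r < scale w l" "scale w l \<le> ?W" by (auto simp: gap_def split: if_splits)
        then have "scale w j < scale w l" using True by linarith
        then have "(4::real) ^ j < 4 ^ l" using w(1) by (subst (asm) mult_less_cancel_right_pos)
        then have "j < l" using power_strict_increasing_iff[of "4::real"] by simp
        then have "(4::real) ^ Suc j \<le> 4 ^ l" by (intro power_increasing) auto
        then have "4 ^ Suc j * w \<le> 4 ^ l * w" using w by (intro mult_right_mono) auto
        moreover have "4 ^ Suc j * w = 4 * scale w j" by simp
        ultimately show False using l j by linarith
      qed
      then show ?thesis using B by simp
    next
      case False
      define v where "v = sqrt (Lk * r / scale w j)"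
      have v: "0 < v" "v < 1" "v\<^sup>2 = Lk * r / scale w j"
        using False L r sc[of j] by (auto simp: v_def)
      have Bj: "B j = v" using v rW j by (simp add: B_def damp_def v_def[symmetric])
      have "?n \<le> 2 * sqrt (scale w j / (Lk * r))"
        unfolding gap_def using L r by (intro count_scales_le[OF w(1) _ j(3)]) simp
      also have "sqrt (scale w j / (Lk * r)) = 1 / v"
        by (simp add: v_def real_sqrt_divide)
      finally have n: "?n \<le> 2 / v" by simp
      have "r / ?W \<le> r / scale w j" using r sc[of j] j by (intro divide_left_mono) auto
      also have "\<dots> = v\<^sup>2 / Lk" using v(3) L by simp
      finally have "60 * logk * (r / ?W) * ?n \<le> 60 * logk * (v\<^sup>2 / Lk) * (2 / v)"
        using n L r W v w by (intro mult_mono) (auto simp: gap_def intro!: sum_nonneg divide_nonneg_nonneg)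
      also have "\<dots> = 12 / 1000000 * v"
        using v(1) logk_ge_1 by (simp add: field_simps power2_eq_square)
      also have "\<dots> \<le> v / 40000" using v(1) by simp
      finally show ?thesis using Bj by simp
    qed
    then have "60 * logk * (r / ?W) * ?n / d \<le> B j / 40000 / d"
      by (intro divide_right_mono) auto
    moreover have "(\<Sum>l<N. 3 * logk * gap l) * (20 * r / (d * ?W)) = 60 * logk * (r / ?W) * ?n / d"
      by (simp only: sum_distrib_left[symmetric]) (simp add: field_simps)
    moreover have "B j / (20000 * d) = 2 * (B j / 40000 / d)" "B j / (40000 * d) = B j / 40000 / d"
      by simp_all
    ultimately show ?thesis by linarith
  qed
  also have "\<dots> \<le> scale_sum c w N P S - min 1 (Lk * r / ?W) / (40000 * d)"
  proof -
    \<comment> \<open>Replacing \<open>reach S\<close> by the smaller \<open>scale w j\<close> and a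
      number up to 1 by its root both increase the minimum, which then equals
      \<open>B j\<close>.\<close>
    define v where "v = Lk * r / scale w j"
    have "0 < v" using L r sc[of j] by (auto simp: v_def)
    have "Lk * r / ?W \<le> v" unfolding v_def using L r sc[of j] j by (intro divide_left_mono) auto
    then have "min 1 (Lk * r / ?W) \<le> min 1 v" by simp
    also have "\<dots> \<le> min 1 (sqrt v)"
    proof (cases "v \<le> 1")
      case True
      then have "v\<^sup>2 \<le> v" using mult_left_mono[of v 1 v] \<open>0 < v\<close> by (simp add: power2_eq_square)
      then have "v \<le> sqrt v" by (rule real_le_rsqrt)
      then show ?thesis using True by simp
    next
      case False
      then have "1 \<le> sqrt v" by simp
      then show ?thesis by simp
    qed
    also have "\<dots> = B j" using rW j by (simp add: B_def damp_def v_def)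
    finally show ?thesis using d by (intro diff_left_mono divide_right_mono) auto
  qed
  finally show ?thesis using False by (simp add: r_def)
qed


lemma scale_sum_nonneg:
  assumes S: "S \<in> groups" and "0 < w"
  shows "0 \<le> scale_sum c w N P S"
proof (cases "S \<inter> P = {}")
  case False
  then have "0 \<le> fallback P S" by (rule fallback_nonneg[OF S])
  then show ?thesis
    using \<open>0 < w\<close> logk_ge_1 unfolding scale_sum_def
    by (auto intro!: sum_nonneg mult_nonneg_nonneg clock_nonneg damp_nonneg)
qed (simp add: scale_sum_def)

text \<open>One factor \<open>logk\<close> comes from the clocks; the number of effectively undamped
  scales gives \<open>ln Lk\<close>, of order \<open>log log k\<close>.\<close>

lemma scale_sum_le:
  assumes S: "S \<in> groups" and "0 < w" and pos: "\<And>e. e \<in> C \<Longrightarrow> 0 < dist_d d x e"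
  shows "scale_sum c w N P S \<le> 3 * logk * (ln (16 * Lk) + 2)"
proof (cases "S \<inter> P = {}")
  case False
  have r: "0 < fallback P S" using fallback_attained[OF S False] S pos by force
  have L: "1 \<le> Lk" using logk_ge_1 by simp
  have "scale_sum c w N P S \<le> (\<Sum>j<N. 3 * logk * damp Lk (scale w j) (fallback P S))"
    using False r \<open>0 < w\<close> L unfolding scale_sum_def
    by (auto intro!: sum_mono mult_right_mono clock_le[OF S] damp_nonneg)
  also have "\<dots> = 3 * logk * (\<Sum>j<N. damp Lk (scale w j) (fallback P S))"
    by (simp add: sum_distrib_left)
  also have "\<dots> \<le> 3 * logk * (ln (16 * Lk) + 2)"
    using logk_ge_1 by (intro mult_left_mono sum_damp_le r L \<open>0 < w\<close>) auto
  finally show ?thesis .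
next
  case True
  have "0 \<le> ln (16 * Lk)" using logk_ge_1 by (intro ln_ge_zero) simp
  then show ?thesis using True logk_ge_1 by (simp add: scale_sum_def)
qed

lemma scale_sum_eq_0:
  assumes S: "S \<in> groups" and "0 < w" "reach S < w"
  shows "scale_sum c w N P S = 0"
proof -
  have "clock c (scale w j) S = 0" for j
    using assms(2,3) by (intro clock_eq_0[OF S]) (auto intro: less_le_trans[of _ "1 * w"] mult_right_mono)
  then show ?thesis by (simp add: scale_sum_def)
qed

text \<open>Combines the squared reach with \<open>value_of_le_dist_reach\<close> at the nearest
  survivor.\<close>

lemma value_of_fallback_le:
  assumes S: "S \<in> groups" and "0 < reach S" and ne: "S \<inter> P \<noteq> {}"
  shows "value_of (S \<inter> P) \<le> (reach S)\<^sup>2 * min 1 (Lk * fallback P S / reach S)"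
proof -
  have SP: "S \<inter> P \<in> groups" using S ne by auto
  obtain e where e: "e \<in> S \<inter> P" "fallback P S = dist_d d x e" using fallback_attained[OF S ne] by blast
  have R: "reach (S \<inter> P) \<le> reach S" by (rule reach_mono[OF S _ ne]) auto
  have "value_of (S \<inter> P) \<le> (reach S)\<^sup>2"
    using value_of_le_reach[OF SP] power_mono[OF R reach_nonneg[OF SP], of 2] by linarith
  moreover have "value_of (S \<inter> P) \<le> (reach S)\<^sup>2 * (Lk * fallback P S / reach S)"
  proof -
    have "value_of (S \<inter> P) \<le> Lk * dist_d d x e * reach (S \<inter> P)"
      by (rule value_of_le_dist_reach[OF SP e(1)])
    also have "\<dots> \<le> Lk * dist_d d x e * reach S"
      using R logk_ge_1 by (intro mult_left_mono) auto
    finally show ?thesis using \<open>0 < reach S\<close> by (simp add: e(2) power2_eq_square mult_ac)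
  qed
  ultimately show ?thesis by (simp add: min_def)
qed

text \<open>For every pattern the decrease of \<open>scale_sum\<close> pays exactly for the loss:
  1280000 / 40000 = 32 on one side, and 2 * 16 = 32 on the other, from \<open>expect_lost_le\<close>
  and \<open>reach S \<le> 4 * radius S\<close>. After the loss of \<open>c\<close> the potential is
  \<open>value_of\<close>, itself superharmonic.\<close>

lemma superharmonic_main:
  assumes c: "c \<in> C" and pos: "\<And>e. e \<in> C \<Longrightarrow> 0 < dist_d d x e"
    and w: "w = 8 * dist_d d x c" and N: "reach C < scale w N"
  defines "\<Phi> \<equiv> \<lambda>S. if c \<in> S then w\<^sup>2 + 1280000 / \<epsilon> * (\<Sum>P\<in>Pow C. weight c P * scale_sum c w N P S) else value_of S"
  shows "superharmonic \<Phi>"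
  unfolding superharmonic_def
proof (intro conjI ballI)
  have w0: "0 < w" using pos[OF c] w by simp
  have nn: "0 \<le> 1280000 / \<epsilon> * (\<Sum>P\<in>Pow C. weight c P * scale_sum c w N P S)" if "S \<in> groups" for S
    using eps_pos scale_sum_nonneg[OF that w0] weight_nonneg
    by (intro mult_nonneg_nonneg sum_nonneg) auto
  {
    fix S assume S: "S \<in> groups"
    show "0 \<le> \<Phi> S"
      using nn[OF S] value_of_nonneg[OF S] by (auto simp: \<Phi>_def intro!: add_nonneg_nonneg)
    \<comment> \<open>When \<open>reach S < w\<close>, the term \<open>w\<^sup>2\<close> alone
      dominates every outcome; only the last case needs the balance of clocks and losses.\<close>
    consider "c \<notin> S" | "c \<in> S" "reach S < w" | "c \<in> S" "w \<le> reach S" by linarith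
    then show "expect S \<Phi> \<le> \<Phi> S"
    proof cases
      case 1
      then have "expect S \<Phi> \<le> expect S value_of"
        by (intro expect_mono[OF S]) (auto simp: \<Phi>_def)
      also have "\<dots> \<le> value_of S" using superharmonic_value_of S by (simp add: superharmonic_def)
      finally show ?thesis using 1 by (simp add: \<Phi>_def)
    next
      case 2
      have "\<Phi> T \<le> w\<^sup>2" if T: "T \<subseteq> S" "T \<noteq> {}" for T
      proof -
        have TG: "T \<in> groups" using S T by auto
        have R: "reach T < w" using reach_mono[OF S T] 2 by simp
        then have "(reach T)\<^sup>2 \<le> w\<^sup>2" using reach_nonneg[OF TG] by (intro power_mono) auto
        then show ?thesis
          using scale_sum_eq_0[OF TG w0 R] value_of_le_reach[OF TG] by (auto simp: \<Phi>_def)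
      qed
      then have "expect S \<Phi> \<le> w\<^sup>2" by (rule expect_le_const[OF S])
      also have "\<dots> \<le> \<Phi> S" using nn[OF S] 2 by (simp add: \<Phi>_def)
      finally show ?thesis .
    next
      case 3
      let ?W = "reach S"
      have W: "0 < ?W" using w0 3 by simp
      have R4: "?W \<le> 4 * radius S" using 3 w by (intro reach_le_radius[OF S]) auto
      have R: "0 < radius S" using R4 W by linarith
      have "?W \<le> reach C" using S by (intro reach_mono) auto
      then have NS: "?W < scale w N" using N by linarith
      define m where "m P = (if S \<inter> P = {} then 0 else min 1 (Lk * fallback P S / ?W))" for P
      have pt: "\<Phi> T \<le> (w\<^sup>2 + 1280000 / \<epsilon> * (\<Sum>P\<in>Pow C. weight c P * scale_sum c w N P T)) + of_bool (c \<notin> T) * value_of T"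
        if T: "T \<subseteq> S" "T \<noteq> {}" for T
      proof -
        have TG: "T \<in> groups" using S T by auto
        show ?thesis using nn[OF TG] by (auto simp: \<Phi>_def)
      qed
      have lost: "expect S (\<lambda>T. of_bool (c \<notin> T) * value_of T) \<le> 32 / (d * \<epsilon>) * (\<Sum>P\<in>Pow C. weight c P * m P)"
      proof -
        have "expect S (\<lambda>T. of_bool (c \<notin> T) * value_of T)
          \<le> 2 / (d * \<epsilon> * (radius S)\<^sup>2) * (\<Sum>P\<in>Pow C. weight c P * (if S \<inter> P = {} then 0 else value_of (S \<inter> P)))"
          using S value_of_nonneg by (intro expect_lost_le[OF S 3(1) R]) auto
        also have "\<dots> \<le> 2 / (d * \<epsilon> * (radius S)\<^sup>2) * (\<Sum>P\<in>Pow C. weight c P * (?W\<^sup>2 * m P))"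
          using value_of_fallback_le[OF S W] weight_nonneg eps_pos
          by (intro mult_left_mono sum_mono) (auto simp: m_def)
        also have "\<dots> = (?W / radius S)\<^sup>2 * (2 / (d * \<epsilon>)) * (\<Sum>P\<in>Pow C. weight c P * m P)"
          by (simp add: sum_distrib_left sum_divide_distrib power_divide mult_ac)
        also have "\<dots> \<le> 4\<^sup>2 * (2 / (d * \<epsilon>)) * (\<Sum>P\<in>Pow C. weight c P * m P)"
        proof (intro mult_right_mono power_mono)
          show "0 \<le> (\<Sum>P\<in>Pow C. weight c P * m P)"
          proof (intro sum_nonneg mult_nonneg_nonneg weight_nonneg)
            fix P show "0 \<le> m P"
            proof (cases "S \<inter> P = {}")
              case False
              then have "0 \<le> fallback P S" by (rule fallback_nonneg[OF S])
              then show ?thesis using W logk_ge_1 by (simp add: m_def)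
            qed (simp add: m_def)
          qed
        qed (use R R4 W eps_pos in \<open>auto simp: pos_divide_le_eq\<close>)
        finally show ?thesis by simp
      qed
      have "expect S \<Phi> \<le> expect S (\<lambda>T. (w\<^sup>2 + 1280000 / \<epsilon> * (\<Sum>P\<in>Pow C. weight c P * scale_sum c w N P T)) + of_bool (c \<notin> T) * value_of T)"
        by (rule expect_mono[OF S pt])
      also have "\<dots> = (w\<^sup>2 + 1280000 / \<epsilon> * (\<Sum>P\<in>Pow C. weight c P * expect S (scale_sum c w N P))) + expect S (\<lambda>T. of_bool (c \<notin> T) * value_of T)"
        by (simp only: expect_add[OF S] expect_cmult[OF S] expect_sum[OF S] expect_const[OF S])
      also have "\<dots> \<le> (w\<^sup>2 + 1280000 / \<epsilon> * (\<Sum>P\<in>Pow C. weight c P * (scale_sum c w N P S - m P / (40000 * d))))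
          + 32 / (d * \<epsilon>) * (\<Sum>P\<in>Pow C. weight c P * m P)"
        using expect_scale_sum_le[OF S 3(1) w0 _ 3(2) NS pos] w weight_nonneg eps_pos lost
        by (intro add_mono mult_left_mono sum_mono) (auto simp: m_def)
      also have "\<dots> = \<Phi> S"
        using 3 d by (simp add: \<Phi>_def right_diff_distrib sum_subtractf sum_divide_distrib[symmetric])
      finally show ?thesis .
    qed
  }
  fix e assume "e \<in> C"
  show "(dist_d d x e)\<^sup>2 \<le> \<Phi> {e}"
  proof (cases "e = c")
    case True
    have "(dist_d d x c)\<^sup>2 \<le> w\<^sup>2" unfolding w by (intro power_mono) auto
    then show ?thesis using nn[of "{c}"] c True by (simp add: \<Phi>_def)
  next
    case False
    then show ?thesis using superharmonic_value_of \<open>e \<in> C\<close> by (simp add: \<Phi>_def superharmonic_def)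
  qed
qed

text \<open>Evaluate the main potential at \<open>C\<close> and sum the weights. Since
  \<open>c\<close> is nearest, a positive distance of \<open>c\<close> makes all distances positive;
  distance 0 is settled by \<open>value_of_le_dist_reach\<close>.\<close>

lemma value_of_C_le:
  assumes c: "c \<in> C" and near: "\<And>e. e \<in> C \<Longrightarrow> dist_d d x c \<le> dist_d d x e"
  shows "value_of C \<le> (64 + 3840000 / \<epsilon> * logk * (ln (16 * Lk) + 2)) * (dist_d d x c)\<^sup>2"
proof (cases "dist_d d x c = 0")
  case True
  then show ?thesis using value_of_le_dist_reach[of C c] c by auto
next
  case False
  let ?D = "dist_d d x c"
  define w where "w = 8 * ?D"
  have D: "0 < ?D" using False dist_d_nonneg[of d x c] by linarith
  have pos: "0 < dist_d d x e" if "e \<in> C" for e using near[OF that] D by linarith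
  have w0: "0 < w" using D by (simp add: w_def)
  have CG: "C \<in> groups" using c by auto
  obtain N where N: "reach C < scale w N" using scale_bound_exists[OF w0] .
  have "value_of C \<le> w\<^sup>2 + 1280000 / \<epsilon> * (\<Sum>P\<in>Pow C. weight c P * scale_sum c w N P C)"
    using value_of_le[OF CG superharmonic_main[OF c pos w_def N]] c by simp
  also have "\<dots> \<le> w\<^sup>2 + 1280000 / \<epsilon> * (\<Sum>P\<in>Pow C. weight c P * (3 * logk * (ln (16 * Lk) + 2)))"
    using scale_sum_le[OF CG w0 pos] weight_nonneg eps_pos
    by (intro add_left_mono mult_left_mono sum_mono) auto
  also have "\<dots> = w\<^sup>2 + 1280000 / \<epsilon> * (?D\<^sup>2 * (3 * logk * (ln (16 * Lk) + 2)))"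
    by (simp only: sum_distrib_right[symmetric] sum_weight)
  also have "\<dots> = (64 + 3840000 / \<epsilon> * logk * (ln (16 * Lk) + 2)) * ?D\<^sup>2"
    by (simp add: w_def power_mult_distrib algebra_simps)
  finally show ?thesis .
qed


section \<open>Termination and the cost of the tree\<close>

lemma nn_integral_descend_le:
  assumes \<Phi>: "superharmonic \<Phi>" and S: "S \<in> groups"
  shows "(\<integral>\<^sup>+s. ennreal (\<Phi> (descend S s)) \<partial>M) \<le> ennreal (\<Phi> S)"
proof -
  have nn: "0 \<le> \<Phi> (descend S s)" for s
    using \<Phi> descend_groups[OF S] unfolding superharmonic_def by blast
  have "(\<integral>\<^sup>+s. ennreal (\<Phi> (descend S s)) \<partial>M) = ennreal (expect S \<Phi>)"
    unfolding expect_def using nn by (intro nn_integral_eq_integral integrable_descend[OF S]) auto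
  also have "\<dots> \<le> ennreal (\<Phi> S)"
    using \<Phi> S unfolding superharmonic_def by (intro ennreal_leI) blast
  finally show ?thesis .
qed

text \<open>Divide-and-Share depends on a leaf only through its center set, and leaves with equal
  center sets are treated alike. So forgetting the cells leaves a Markov chain on families of center
  sets, which suffices to decide termination.\<close>

definition children :: "pt set \<Rightarrow> sample \<Rightarrow> pt set set" where
  "children S s = (if card S \<ge> 2 \<and> lefts S s \<noteq> {} \<and> rights S s \<noteq> {} then {lefts S s, rights S s} else {S})"

definition split_all :: "pt set set \<Rightarrow> sample \<Rightarrow> pt set set" where
  "split_all F s = (\<Union>S\<in>F. children S s)"

lemma children_subset: "T \<in> children S s \<Longrightarrow> T \<subseteq> S"
  by (auto simp: children_def lefts_def rights_def split: if_splits)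

lemma children_nonempty: "S \<noteq> {} \<Longrightarrow> T \<in> children S s \<Longrightarrow> T \<noteq> {}"
  by (auto simp: children_def split: if_splits)

lemma split_all_groups: "F \<subseteq> groups \<Longrightarrow> split_all F s \<subseteq> groups"
proof
  fix T assume F: "F \<subseteq> groups" and "T \<in> split_all F s"
  then obtain S where S: "S \<in> F" "T \<in> children S s" by (auto simp: split_all_def)
  have "S \<subseteq> C" "S \<noteq> {}" using S F by auto
  then have "T \<subseteq> C" "T \<noteq> {}" using children_subset[OF S(2)] children_nonempty[OF _ S(2)] by auto
  then show "T \<in> groups" by simp
qed

lemma divide_share_eq:
  "divide_share d med \<epsilon> s (A, S) =
    (if lefts S s \<noteq> {} \<and> rights S s \<noteq> {}
     then {(A \<inter> {y. y (fst s) \<le> cut S s}, lefts S s), (A \<inter> {y. y (fst s) > cut S s}, rights S s)}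
     else {(A, S)})"
  unfolding divide_share_def Let_def lefts_def rights_def cut_def radius_def
  by (cases s) (simp only: prod.case fst_conv snd_conv)

lemma snd_tree_step: "snd ` tree_step d med \<epsilon> s L = split_all (snd ` L) s"
proof -
  have "snd ` (if card (snd u) \<ge> 2 then divide_share d med \<epsilon> s u else {u}) = children (snd u) s" for u
    by (cases u) (auto simp: divide_share_eq children_def)
  then show ?thesis by (simp only: tree_step_def split_all_def image_UN image_image)
qed

lemma snd_leaves: "snd ` leaves d med \<epsilon> C \<omega> t = chain split_all {C} \<omega> t"
  by (induction t) (simp_all add: snd_tree_step)

lemma child_of_x:
  assumes "x \<in> A"
  shows "\<exists>A'. (A', descend S s) \<in> (if card S \<ge> 2 then divide_share d med \<epsilon> s (A, S) else {(A, S)}) \<and> x \<in> A'"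
proof (cases "card S \<ge> 2 \<and> lefts S s \<noteq> {} \<and> rights S s \<noteq> {}")
  case True
  show ?thesis
  proof (cases "x (fst s) \<le> cut S s")
    case le: True
    show ?thesis
      using True le assms by (intro exI[of _ "A \<inter> {y. y (fst s) \<le> cut S s}"]) (simp add: divide_share_eq descend_def)
  next
    case False
    show ?thesis
      using True False assms by (intro exI[of _ "A \<inter> {y. y (fst s) > cut S s}"]) (simp add: divide_share_eq descend_def)
  qed
next
  case False
  then have "descend S s = S" unfolding descend_def by (rule if_not_P)
  then show ?thesis using False assms by (intro exI[of _ A]) (auto simp: divide_share_eq)
qed

text \<open>The two cells of a split are complementary within their parent, so \<open>x\<close>
  enters exactly one of them, the one selected by \<open>descend\<close>. The second half makes the
  \<open>THE\<close> in \<open>tree_cost\<close> well defined.\<close>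

lemma leaf_of_x:
  "(\<exists>A. (A, chain descend C \<omega> t) \<in> leaves d med \<epsilon> C \<omega> t \<and> x \<in> A) \<and>
   (\<forall>u\<in>leaves d med \<epsilon> C \<omega> t. x \<in> fst u \<longrightarrow> snd u = chain descend C \<omega> t)"
proof (induction t)
  case (Suc t)
  let ?S = "chain descend C \<omega> t" and ?L = "leaves d med \<epsilon> C \<omega> t" and ?s = "\<omega> t"
  obtain A where A: "(A, ?S) \<in> ?L" "x \<in> A" using Suc by blast
  have step: "tree_step d med \<epsilon> ?s ?L = (\<Union>u\<in>?L. if card (snd u) \<ge> 2 then divide_share d med \<epsilon> ?s u else {u})"
    by (simp add: tree_step_def)
  have "\<exists>A'. (A', descend ?S ?s) \<in> (if card ?S \<ge> 2 then divide_share d med \<epsilon> ?s (A, ?S) else {(A, ?S)}) \<and> x \<in> A'"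
    by (rule child_of_x[OF A(2)])
  then have ex: "\<exists>A'. (A', descend ?S ?s) \<in> tree_step d med \<epsilon> ?s ?L \<and> x \<in> A'"
    unfolding step using A(1) by fastforce
  have "snd v = descend ?S ?s" if v: "v \<in> tree_step d med \<epsilon> ?s ?L" "x \<in> fst v" for v
  proof -
    obtain B T where u: "(B, T) \<in> ?L" "v \<in> (if card T \<ge> 2 then divide_share d med \<epsilon> ?s (B, T) else {(B, T)})"
    proof -
      obtain u where u: "u \<in> ?L" "v \<in> (if card (snd u) \<ge> 2 then divide_share d med \<epsilon> ?s u else {u})"
        using v(1) unfolding step by (rule UN_E)
      obtain B T where "u = (B, T)" by (cases u)
      show thesis using u by (intro that[of B T]) (simp_all only: \<open>u = (B, T)\<close> snd_conv)
    qed
    have "x \<in> B" using u(2) v(2) by (auto simp: divide_share_eq split: if_splits)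
    then have "T = ?S" using Suc u(1) by force
    then show ?thesis using u(2) v(2) by (auto simp: divide_share_eq descend_def split: if_splits)
  qed
  then show ?case using ex by simp
qed simp

lemma finished_iff: "finished L \<longleftrightarrow> (\<forall>S\<in>snd ` L. card S \<le> 1)"
  by (auto simp: finished_def)

lemma tree_step_finished: "finished L \<Longrightarrow> tree_step d med \<epsilon> s L = L"
  by (force simp: finished_def tree_step_def)

lemma leaves_stable:
  assumes "finished (leaves d med \<epsilon> C \<omega> t)"
  shows "leaves d med \<epsilon> C \<omega> (t + n) = leaves d med \<epsilon> C \<omega> t"
  by (induction n) (simp_all add: tree_step_finished assms)

lemma chain_descend_groups: "chain descend C \<omega> t \<in> groups"
proof (induction t)
  case 0
  show ?case using card_C by auto
next
  case (Suc t)
  then show ?case using descend_groups[OF Suc] by (simp only: chain.simps)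
qed

text \<open>From the finishing time on, the chain stays at the singleton of the output center, where
  the potential dominates the cost.\<close>

lemma tree_cost_le_liminf:
  assumes \<Phi>: "superharmonic \<Phi>" and fin: "\<exists>t. finished (leaves d med \<epsilon> C \<omega> t)"
  shows "tree_cost d med \<epsilon> C x \<omega> \<le> liminf (\<lambda>t. ennreal (\<Phi> (chain descend C \<omega> t)))"
proof -
  define t0 where "t0 = (LEAST t. finished (leaves d med \<epsilon> C \<omega> t))"
  have t0: "finished (leaves d med \<epsilon> C \<omega> t0)" unfolding t0_def using fin by (rule LeastI_ex)
  let ?L = "leaves d med \<epsilon> C \<omega> t0" and ?S = "chain descend C \<omega> t0"
  have "card ?S \<le> 1" using t0 leaf_of_x[of \<omega> t0] by (auto simp: finished_def)
  moreover have S: "?S \<in> groups" by (rule chain_descend_groups)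
  ultimately have "card ?S = 1"
    using finite_group[OF S] card_gt_0_iff[of ?S] by (metis DiffE One_nat_def Suc_leI le_antisym singletonI)
  then obtain c where c: "?S = {c}" by (rule card_1_singletonE)
  then have "c \<in> C" using S by simp
  have the: "(THE c. \<exists>A. (A, {c}) \<in> ?L \<and> x \<in> A) = c"
    using leaf_of_x[of \<omega> t0] unfolding c by (intro the_equality) force+
  have cost: "tree_cost d med \<epsilon> C x \<omega> = ennreal ((dist_d d x c)\<^sup>2)"
    using fin the by (simp add: tree_cost_def t0_def[symmetric] dist_d_power2 sqdist_def)
  have later: "chain descend C \<omega> t = {c}" if "t0 \<le> t" for t
  proof -
    obtain A where A: "(A, {c}) \<in> ?L" "x \<in> A" using leaf_of_x[of \<omega> t0] c by auto
    have "leaves d med \<epsilon> C \<omega> t = ?L" using leaves_stable[OF t0, of "t - t0"] that by simp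
    then show ?thesis using leaf_of_x[of \<omega> t, THEN conjunct2, THEN bspec, of "(A, {c})"] A by simp
  qed
  have "(dist_d d x c)\<^sup>2 \<le> \<Phi> {c}" using \<Phi> \<open>c \<in> C\<close> by (simp add: superharmonic_def)
  then show ?thesis
    unfolding cost
    by (intro Liminf_bounded eventually_sequentiallyI[of t0]) (simp add: later ennreal_leI)
qed

text \<open>The downward closure of the current family of center sets only shrinks, and it loses a maximal
  member whenever that member is split properly.\<close>

definition unsplit :: "pt set set \<Rightarrow> pt set set" where
  "unsplit F = {T. card T \<ge> 2 \<and> (\<exists>S\<in>F. T \<subseteq> S)}"

lemma unsplit_subset: "F \<subseteq> groups \<Longrightarrow> unsplit F \<subseteq> Pow C"
  by (auto simp: unsplit_def)

lemma finite_unsplit: "F \<subseteq> groups \<Longrightarrow> finite (unsplit F)"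
  using unsplit_subset finite_C by (meson finite_Pow_iff finite_subset)

lemma unsplit_split_all: "unsplit (split_all F s) \<subseteq> unsplit F"
proof
  fix T assume "T \<in> unsplit (split_all F s)"
  then obtain S S' where "card T \<ge> 2" "T \<subseteq> S'" "S' \<in> children S s" "S \<in> F"
    by (auto simp: unsplit_def split_all_def)
  moreover from this have "T \<subseteq> S" using children_subset by blast
  ultimately show "T \<in> unsplit F" by (auto simp: unsplit_def)
qed

lemma measurable_split_all:
  assumes F: "F \<subseteq> groups"
  shows "split_all F \<in> M \<rightarrow>\<^sub>M count_space (Pow groups)"
proof -
  have finF: "finite F" using F finite_groups finite_subset by blast
  have mem: "Measurable.pred M (\<lambda>s. T \<in> children S s)" if S: "S \<in> groups" for S T
  proof -
    note [measurable] = measurable_lefts[OF S] measurable_rights[OF S]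
    have [measurable]: "Measurable.pred M (\<lambda>s. P (lefts S s))" "Measurable.pred M (\<lambda>s. P (rights S s))" for P
      using measurable_compose[OF measurable_lefts[OF S], of P "count_space UNIV"]
        measurable_compose[OF measurable_rights[OF S], of P "count_space UNIV"]
      by (simp_all add: measurable_count_space_eq1)
    have "Measurable.pred M (\<lambda>s. (card S \<ge> 2 \<and> lefts S s \<noteq> {} \<and> rights S s \<noteq> {} \<and> (T = lefts S s \<or> T = rights S s))
       \<or> (\<not> (card S \<ge> 2 \<and> lefts S s \<noteq> {} \<and> rights S s \<noteq> {}) \<and> T = S))"
      by measurable
    moreover have "(\<lambda>s. T \<in> children S s) = (\<lambda>s. (card S \<ge> 2 \<and> lefts S s \<noteq> {} \<and> rights S s \<noteq> {} \<and> (T = lefts S s \<or> T = rights S s))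
       \<or> (\<not> (card S \<ge> 2 \<and> lefts S s \<noteq> {} \<and> rights S s \<noteq> {}) \<and> T = S))"
      by (auto simp: children_def fun_eq_iff)
    ultimately show ?thesis by simp
  qed
  have "split_all F -` {G} \<inter> space M \<in> sets M" if G: "G \<subseteq> groups" for G
  proof -
    have "split_all F -` {G} \<inter> space M = {s \<in> space M. \<forall>T\<in>groups. (\<exists>S\<in>F. T \<in> children S s) \<longleftrightarrow> T \<in> G}"
      using split_all_groups[OF F] G by (fastforce simp: split_all_def)
    also have "\<dots> \<in> sets M"
    proof (rule sets.sets_Collect_finite_All'[OF _ finite_groups])
      show "{s \<in> space M. (\<exists>S\<in>F. T \<in> children S s) \<longleftrightarrow> T \<in> G} \<in> sets M" for T
      proof -
        have "{s \<in> space M. \<exists>S\<in>F. T \<in> children S s} \<in> sets M"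
          using mem F finF by (intro sets.sets_Collect_finite_Ex) (auto simp: pred_def)
        moreover from sets.sets_Collect_neg[OF this] have "{s \<in> space M. \<not> (\<exists>S\<in>F. T \<in> children S s)} \<in> sets M" .
        ultimately show ?thesis by (cases "T \<in> G") simp_all
      qed
      show "groups \<noteq> {}" using F card_C by force
    qed
    finally show ?thesis .
  qed
  then show ?thesis
    using finite_groups split_all_groups[OF F] by (subst measurable_count_space_eq2) auto
qed

text \<open>A largest member \<open>S\<close> of the closure belongs to \<open>F\<close> and is
  split properly with probability at least \<open>1 / (4 * d)\<close>; then \<open>S\<close> leaves
  the closure. As the closure has at most \<open>2 ^ card C\<close> members, losing one is a
  relative decrease.\<close>

lemma nn_integral_unsplit_le:
  assumes F: "F \<subseteq> groups"
  shows "(\<integral>\<^sup>+s. of_nat (card (unsplit (split_all F s))) \<partial>M)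
    \<le> ennreal (1 - 1 / (4 * d * 2 ^ card C)) * of_nat (card (unsplit F))"
proof (cases "unsplit F = {}")
  case True
  then have "unsplit (split_all F s) = {}" for s using unsplit_split_all[of F s] by blast
  then show ?thesis by simp
next
  case False
  let ?N = "\<lambda>F. card (unsplit F)"
  obtain S where S: "S \<in> unsplit F" and max: "\<And>T. T \<in> unsplit F \<Longrightarrow> card T \<le> card S"
  proof -
    have "Max (card ` unsplit F) \<in> card ` unsplit F"
      using finite_unsplit[OF F] False by (intro Max_in) auto
    then obtain S where "S \<in> unsplit F" "card S = Max (card ` unsplit F)" by auto
    then show thesis using that[of S] finite_unsplit[OF F] by simp
  qed
  obtain S0 where S0: "S0 \<in> F" "S \<subseteq> S0" using S by (auto simp: unsplit_def)
  \<comment> \<open>By maximality no other member of \<open>F\<close> contains \<open>S\<close>, so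
    \<open>S\<close> cannot survive inside a descendant of a different member.\<close>
  have eq: "T = S" if "T \<in> F" "S \<subseteq> T" for T
  proof -
    have "finite T" using F that finite_group by blast
    then have "card S \<le> card T" using that by (intro card_mono)
    then have "T \<in> unsplit F" using S that by (auto simp: unsplit_def)
    then have "card S = card T" using max \<open>card S \<le> card T\<close> by (intro le_antisym)
    then show ?thesis by (rule card_subset_eq[OF \<open>finite T\<close> that(2), symmetric])
  qed
  have SG: "S \<in> groups" and card: "card S \<ge> 2" using S0 eq F S by (auto simp: unsplit_def)
  have R: "0 < radius S" by (rule radius_pos[OF SG card])
  \<comment> \<open>A center that attains the radius makes the probability in
    \<open>exists_split_event\<close> equal to \<open>1 / (4 * d)\<close>.\<close>
  have "radius S \<in> (\<lambda>c. dist_d d c (med S)) ` S"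
    unfolding radius_def using finite_group[OF SG] SG by (intro Max_in) auto
  then obtain e where e: "e \<in> S" "dist_d d e (med S) = radius S" by auto
  obtain E where E: "E \<in> sets M" "1 / (4 * d) \<le> measure M E"
    and split: "\<And>s. s \<in> E \<Longrightarrow> {} \<subset> lefts S s \<and> lefts S s \<subset> S \<and> {} \<subset> rights S s \<and> rights S s \<subset> S"
    using exists_split_event[OF SG card e(1)] R unfolding e(2) by auto
  have le: "?N (split_all F s) \<le> ?N F" for s
    by (intro card_mono finite_unsplit[OF F] unsplit_split_all)
  have less: "?N (split_all F s) \<le> ?N F - 1" if "s \<in> E" for s
  proof -
    have "S \<notin> unsplit (split_all F s)"
    proof
      assume "S \<in> unsplit (split_all F s)"
      then obtain T T' where T: "T \<in> F" "T' \<in> children T s" "S \<subseteq> T'"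
        by (auto simp: unsplit_def split_all_def)
      then have "T = S" using eq children_subset[OF T(2)] by blast
      then show False using T split[OF that] card by (auto simp: children_def split: if_splits)
    qed
    then have "unsplit (split_all F s) \<subseteq> unsplit F - {S}" using unsplit_split_all by blast
    then have "?N (split_all F s) \<le> card (unsplit F - {S})"
      using finite_unsplit[OF F] by (intro card_mono) auto
    then show ?thesis using S finite_unsplit[OF F] by simp
  qed
  have N1: "1 \<le> ?N F" using False finite_unsplit[OF F] by (simp add: Suc_le_eq card_gt_0_iff)
  have N2: "?N F \<le> 2 ^ card C"
    using card_mono[OF _ unsplit_subset[OF F]] finite_C by (simp add: card_Pow)
  have "(\<integral>\<^sup>+s. of_nat (?N (split_all F s)) \<partial>M) \<le> (\<integral>\<^sup>+s. ennreal (real (?N F) - indicator E s) \<partial>M)"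
  proof (intro nn_integral_mono)
    fix s
    have "real (?N (split_all F s)) \<le> real (?N F) - indicator E s"
    proof (cases "s \<in> E")
      case True
      then have "?N (split_all F s) + 1 \<le> ?N F" using less[OF True] N1 by linarith
      then show ?thesis using True by simp
    qed (use le[of s] in simp)
    then show "of_nat (?N (split_all F s)) \<le> ennreal (real (?N F) - indicator E s)"
      unfolding ennreal_of_nat_eq_real_of_nat by (rule ennreal_leI)
  qed
  also have "\<dots> = ennreal (\<integral>s. real (?N F) - indicator E s \<partial>M)"
  proof (rule nn_integral_eq_integral)
    show "integrable M (\<lambda>s. real (?N F) - indicator E s)"
      using E by (intro Bochner_Integration.integrable_diff integrable_real_indicator)
        (auto simp: M.emeasure_eq_measure)
  qed (use N1 in \<open>auto simp: indicator_def\<close>)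
  also have "(\<integral>s. real (?N F) - indicator E s \<partial>M) = real (?N F) - measure M E"
    using E M.prob_space by (subst Bochner_Integration.integral_diff) (auto simp: M.emeasure_eq_measure)
  also have "ennreal (real (?N F) - measure M E) \<le> ennreal ((1 - 1 / (4 * d * 2 ^ card C)) * ?N F)"
  proof (rule ennreal_leI)
    have "real (?N F) \<le> 2 ^ card C" using of_nat_mono[OF N2, where ?'a=real] by simp
    then have "real (?N F) / 2 ^ card C / (4 * d) \<le> 1 / (4 * d)" by (intro divide_right_mono) auto
    then show "real (?N F) - measure M E \<le> (1 - 1 / (4 * d * 2 ^ card C)) * ?N F"
      using E by (simp add: algebra_simps)
  qed
  also have "\<dots> = ennreal (1 - 1 / (4 * d * 2 ^ card C)) * of_nat (?N F)"
    by (simp add: ennreal_mult'' ennreal_of_nat_eq_real_of_nat)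
  finally show ?thesis .
qed

text \<open>While the process runs, the integer \<open>card (unsplit F)\<close> is at least 1, but
  its expectation tends to 0; so running forever is contained in a null set.\<close>

lemma AE_finished: "AE \<omega> in run_space d. \<exists>t. finished (leaves d med \<epsilon> C \<omega> t)"
proof -
  let ?N = "\<lambda>\<omega> t. card (unsplit (chain split_all {C} \<omega> t))"
  let ?q = "1 - 1 / (4 * d * 2 ^ card C)"
  have C0: "{C} \<in> Pow groups" using card_C by auto
  have meas: "split_all F \<in> M \<rightarrow>\<^sub>M count_space (Pow groups)" if "F \<in> Pow groups" for F
    using measurable_split_all that by auto
  have cnt: "countable (Pow groups)" using finite_groups by (intro countable_finite) simp
  have chain_m: "(\<lambda>\<omega>. chain split_all {C} \<omega> t) \<in> run_space d \<rightarrow>\<^sub>M count_space (Pow groups)" for t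
    unfolding run_space_def by (rule measurable_chain[OF cnt meas C0])
  have N_m[measurable]: "(\<lambda>\<omega>. of_nat (?N \<omega> t) :: ennreal) \<in> borel_measurable (run_space d)" for t
    by (rule measurable_compose[OF chain_m]) auto
  have decay: "(\<integral>\<^sup>+\<omega>. of_nat (?N \<omega> t) \<partial>run_space d) \<le> ennreal ?q ^ t * of_nat (card (unsplit {C}))" for t
    unfolding run_space_def
    by (rule nn_integral_chain_le[OF prob_space_sample_measure cnt meas _ C0]) (use nn_integral_unsplit_le in auto)
  have q: "0 \<le> ?q" "?q < 1"
  proof -
    have "1 \<le> 4 * real d * 2 ^ card C" using d by (intro mult_ge1_I) auto
    then show "0 \<le> ?q" "?q < 1" by auto
  qed
  have "(\<lambda>t. ?q ^ t * card (unsplit {C})) \<longlonglongrightarrow> 0"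
    using q by (intro tendsto_mult_left_zero LIMSEQ_power_zero) auto
  then have "(\<lambda>t. ennreal (?q ^ t * card (unsplit {C}))) \<longlonglongrightarrow> ennreal 0"
    by (rule tendsto_ennrealI)
  then have lim: "(\<lambda>t. ennreal ?q ^ t * of_nat (card (unsplit {C}))) \<longlonglongrightarrow> 0"
    using q by (simp add: ennreal_mult ennreal_power ennreal_of_nat_eq_real_of_nat)
  let ?A = "{\<omega> \<in> space (run_space d). \<forall>t. 1 \<le> (of_nat (?N \<omega> t) :: ennreal)}"
  have A: "?A \<in> sets (run_space d)" by measurable
  have "emeasure (run_space d) ?A \<le> ennreal ?q ^ t * of_nat (card (unsplit {C}))" for t
  proof -
    have "emeasure (run_space d) ?A = (\<integral>\<^sup>+\<omega>. indicator ?A \<omega> \<partial>run_space d)" using A by simp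
    also have "\<dots> \<le> (\<integral>\<^sup>+\<omega>. of_nat (?N \<omega> t) \<partial>run_space d)"
      by (intro nn_integral_mono) (auto simp: indicator_def)
    finally show ?thesis using decay[of t] by (rule order_trans)
  qed
  then have "emeasure (run_space d) ?A \<le> 0" by (intro LIMSEQ_le_const[OF lim]) auto
  then have null: "emeasure (run_space d) ?A = 0" by simp
  show ?thesis
  proof (rule AE_I[OF _ null A], safe)
    fix \<omega> assume \<omega>: "\<omega> \<in> space (run_space d)" and nf: "\<nexists>t. finished (leaves d med \<epsilon> C \<omega> t)"
    fix t
    have sub: "chain split_all {C} \<omega> t \<subseteq> groups"
      using measurable_space[OF chain_m \<omega>, of t] by simp
    obtain S where S: "S \<in> chain split_all {C} \<omega> t" "\<not> card S \<le> 1"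
      using nf by (auto simp: finished_iff snd_leaves)
    then have "S \<in> unsplit (chain split_all {C} \<omega> t)" by (auto simp: unsplit_def)
    then have "1 \<le> ?N \<omega> t" using finite_unsplit[OF sub] by (auto simp: Suc_le_eq card_gt_0_iff)
    then have "(of_nat 1 :: ennreal) \<le> of_nat (?N \<omega> t)" by (simp only: of_nat_le_iff)
    then show "1 \<le> (of_nat (?N \<omega> t) :: ennreal)" by simp
  qed
qed

text \<open>Fatou's lemma: the cost is almost surely at most the limit inferior of the potential,
  whose expectation never exceeds its initial value.\<close>

lemma nn_integral_tree_cost_le:
  assumes \<Phi>: "superharmonic \<Phi>"
  shows "(\<integral>\<^sup>+\<omega>. tree_cost d med \<epsilon> C x \<omega> \<partial>run_space d) \<le> ennreal (\<Phi> C)"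
proof -
  have C0: "C \<in> groups" using card_C by auto
  have "(\<lambda>\<omega>. chain descend C \<omega> t) \<in> run_space d \<rightarrow>\<^sub>M count_space groups" for t
    unfolding run_space_def by (rule measurable_chain[OF countable_groups measurable_descend C0])
  then have [measurable]: "(\<lambda>\<omega>. ennreal (\<Phi> (chain descend C \<omega> t))) \<in> borel_measurable (run_space d)" for t
    by (rule measurable_compose) auto
  have bound: "(\<integral>\<^sup>+\<omega>. ennreal (\<Phi> (chain descend C \<omega> t)) \<partial>run_space d) \<le> ennreal (\<Phi> C)" for t
  proof -
    have "(\<integral>\<^sup>+\<omega>. ennreal (\<Phi> (chain descend C \<omega> t)) \<partial>run_space d) \<le> 1 ^ t * ennreal (\<Phi> C)"
      unfolding run_space_def
      by (rule nn_integral_chain_le[OF prob_space_sample_measure countable_groups measurable_descend _ C0])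
        (simp_all only: mult_1_left nn_integral_descend_le[OF \<Phi>])
    then show ?thesis by simp
  qed
  have "(\<integral>\<^sup>+\<omega>. tree_cost d med \<epsilon> C x \<omega> \<partial>run_space d)
     \<le> (\<integral>\<^sup>+\<omega>. liminf (\<lambda>t. ennreal (\<Phi> (chain descend C \<omega> t))) \<partial>run_space d)"
    using AE_finished by (intro nn_integral_mono_AE) (auto elim!: eventually_mono intro: tree_cost_le_liminf[OF \<Phi>])
  also have "\<dots> \<le> liminf (\<lambda>t. \<integral>\<^sup>+\<omega>. ennreal (\<Phi> (chain descend C \<omega> t)) \<partial>run_space d)"
    by (rule nn_integral_liminf) measurable
  also have "\<dots> \<le> ennreal (\<Phi> C)"
    using Liminf_mono[of "\<lambda>t. \<integral>\<^sup>+\<omega>. ennreal (\<Phi> (chain descend C \<omega> t)) \<partial>run_space d" "\<lambda>_. ennreal (\<Phi> C)" sequentially] bound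
    by (simp add: Liminf_const)
  finally show ?thesis .
qed

end

theorem theorem3:
  "\<exists>K::real. K > 0 \<and>
    (\<forall>(d::nat) (C::pt set) (\<delta>::real) (med::pt set \<Rightarrow> pt) (x::pt).
       d \<ge> 1 \<longrightarrow> finite C \<longrightarrow> card C \<ge> 3 \<longrightarrow>
       (\<forall>c\<in>C. \<forall>j\<ge>d. c j = 0) \<longrightarrow>
       0 < \<delta> \<longrightarrow> \<delta> < 1 \<longrightarrow>
       (\<forall>S. S \<subseteq> C \<longrightarrow> S \<noteq> {} \<longrightarrow> is_median d S (med S)) \<longrightarrow>
       (\<integral>\<^sup>+ \<omega>. tree_cost d med (eps_param \<delta> (card C)) C x \<omega> \<partial>run_space d)
         \<le> ennreal (K / \<delta> * (ln (real (card C)))\<^sup>2 * ln (ln (real (card C)))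
                    * (MIN c\<in>C. sqdist d x c)))"
proof -
  \<comment> \<open>The least value of \<open>ln (ln k)\<close> for \<open>k \<ge> 3\<close>,
    positive since 3 exceeds the base of the logarithm. It turns additive constants into multiples
    of \<open>ln (ln k)\<close>.\<close>
  define \<kappa> :: real where "\<kappa> = ln (ln 3)"
  define a :: real where "a = ln 160000000 + 2"
  \<comment> \<open>Chosen so that \<open>a + ln l \<le> B * ln l\<close> whenever
    \<open>ln l \<ge> \<kappa>\<close>.\<close>
  define B where "B = a / \<kappa> + 1"
  have "1 < ln (3::real)" using e_less_272 ln_less_cancel_iff[of "exp 1" 3] by simp
  then have \<kappa>: "0 < \<kappa>" by (simp add: \<kappa>_def)
  have a: "0 < a" by (simp add: a_def add_pos_pos)
  have B: "0 < B" using \<kappa> a by (simp add: B_def add_pos_pos)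
  show ?thesis
  proof (intro exI[of _ "3840064 * 320 * B"] conjI allI impI)
    show "0 < 3840064 * 320 * B" using B by simp
    fix d :: nat and C :: "pt set" and \<delta> :: real and med :: "pt set \<Rightarrow> pt" and x :: pt
    assume d: "d \<ge> 1" and fin: "finite C" and card: "card C \<ge> 3" and van: "\<forall>c\<in>C. \<forall>j\<ge>d. c j = 0"
      and \<delta>: "0 < \<delta>" "\<delta> < 1" and med: "\<forall>S. S \<subseteq> C \<longrightarrow> S \<noteq> {} \<longrightarrow> is_median d S (med S)"
    define l where "l = ln (real (card C))"
    define \<epsilon> where "\<epsilon> = eps_param \<delta> (card C)"
    have "ln 3 \<le> l" unfolding l_def using card by (intro ln_mono) auto
    then have l: "1 < l" using \<open>1 < ln 3\<close> by linarith
    have ll: "\<kappa> \<le> ln l" unfolding \<kappa>_def using \<open>ln 3 \<le> l\<close> \<open>1 < ln 3\<close> by (intro ln_mono) auto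
    have \<epsilon>: "0 < \<epsilon>" "\<epsilon> \<le> 1 / 320" "1 / \<epsilon> \<le> 320 * l / \<delta>"
    proof -
      show "0 < \<epsilon>" "\<epsilon> \<le> 1 / 320" using l \<delta> by (auto simp: \<epsilon>_def eps_param_def l_def[symmetric])
      \<comment> \<open>Both terms of the minimum in \<open>eps_param\<close> are at least
        \<open>\<delta> / (320 * l)\<close>; thus \<open>1 / \<epsilon>\<close> supplies the second
        factor \<open>ln k\<close> and the factor \<open>1 / \<delta>\<close>.\<close>
      have "\<delta> / (320 * l) \<le> \<delta> / (15 * l)" using l \<delta> by (intro divide_left_mono) auto
      moreover have "\<delta> / (320 * l) \<le> 1 / 320" using l \<delta> by (simp add: field_simps)
      ultimately have "\<delta> / (320 * l) \<le> \<epsilon>" by (simp add: \<epsilon>_def eps_param_def l_def[symmetric])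
      then show "1 / \<epsilon> \<le> 320 * l / \<delta>" using l \<delta> \<open>0 < \<epsilon>\<close> by (simp add: field_simps)
    qed
    interpret threshold_tree d C med x \<epsilon>
      by unfold_locales (use d fin card van med \<epsilon> in auto)
    have ne: "sqdist d x ` C \<noteq> {}" "finite (sqdist d x ` C)" using card fin by auto
    obtain c where c: "c \<in> C" "Min (sqdist d x ` C) = sqdist d x c"
      using Min_in[OF ne(2,1)] by auto
    have near: "dist_d d x c \<le> dist_d d x e" if "e \<in> C" for e
      using Min_le[OF ne(2), of "sqdist d x e"] that c by (simp add: dist_d_def)
    have D: "(dist_d d x c)\<^sup>2 = Min (sqdist d x ` C)"
      unfolding c(2) by (simp add: dist_d_power2 sqdist_def)
    have "1 \<le> ln (16 * (10000000 * l)) + 2" 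
      using l by (intro add_increasing ln_ge_zero) auto
    have big: "ln (16 * (10000000 * l)) + 2 \<le> B * ln l"
    proof -
      have "ln (16 * (10000000 * l)) + 2 = a + ln l" using l by (simp add: a_def ln_mult)
      also have "a \<le> a / \<kappa> * ln l" using ll \<kappa> a by (simp add: field_simps)
      finally show ?thesis by (simp add: B_def distrib_right)
    qed
    \<comment> \<open>Since \<open>X \<ge> 1\<close>, the additive 64 is absorbed into the multiple
      of \<open>X\<close>: 3840064 = 3840000 + 64.\<close>
    define X where "X = 1 / \<epsilon> * l * (ln (16 * (10000000 * l)) + 2)"
    have "1 \<le> X"
      unfolding X_def using \<epsilon> l \<open>1 \<le> ln (16 * (10000000 * l)) + 2\<close>
      by (intro mult_ge1_I) (auto simp: field_simps)
    moreover have "3840000 / \<epsilon> * l * (ln (16 * (10000000 * l)) + 2) = 3840000 * X"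
      by (simp add: X_def)
    ultimately have "64 + 3840000 / \<epsilon> * l * (ln (16 * (10000000 * l)) + 2)
       \<le> 3840064 * (1 / \<epsilon> * l * (ln (16 * (10000000 * l)) + 2))"
      unfolding X_def[symmetric] by simp
    also have "\<dots> \<le> 3840064 * (320 * l / \<delta> * l * (B * ln l))"
      using \<epsilon> l \<delta> big \<open>1 \<le> ln (16 * (10000000 * l)) + 2\<close> by (intro mult_left_mono mult_mono) auto
    also have "\<dots> = 3840064 * 320 * B / \<delta> * l\<^sup>2 * ln l" by (simp add: power2_eq_square)
    finally have K: "64 + 3840000 / \<epsilon> * l * (ln (16 * (10000000 * l)) + 2) \<le> 3840064 * 320 * B / \<delta> * l\<^sup>2 * ln l" .
    have "(\<integral>\<^sup>+ \<omega>. tree_cost d med \<epsilon> C x \<omega> \<partial>run_space d) \<le> ennreal (value_of C)"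
      by (rule nn_integral_tree_cost_le[OF superharmonic_value_of])
    also have "\<dots> \<le> ennreal ((64 + 3840000 / \<epsilon> * l * (ln (16 * (10000000 * l)) + 2)) * (dist_d d x c)\<^sup>2)"
      unfolding l_def by (intro ennreal_leI value_of_C_le c near)
    also have "\<dots> \<le> ennreal (3840064 * 320 * B / \<delta> * l\<^sup>2 * ln l * (dist_d d x c)\<^sup>2)"
      using K by (intro ennreal_leI mult_right_mono) auto
    finally show "(\<integral>\<^sup>+ \<omega>. tree_cost d med (eps_param \<delta> (card C)) C x \<omega> \<partial>run_space d)
         \<le> ennreal (3840064 * 320 * B / \<delta> * (ln (real (card C)))\<^sup>2 * ln (ln (real (card C)))
                    * (MIN c\<in>C. sqdist d x c))"
      unfolding l_def \<epsilon>_def D .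
  qed
qed

end
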